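(* Let $K$ be a positive integer and $\gamma_j$, $0\le j\le K$, real numbers with $\gamma_0=1$, $\gamma_K\neq0$. Let $P(x)=\sum_{j=0}^K\gamma_jx^{K-j}$ and, for $\alpha>-1$ and $n\ge0$, $$q_n(x)=\sum_{j=0}^{\min(n,K)}\gamma_j\,\mathfrak L^\alpha_{n-j}(x).$$ Assume that $P$ has $N^{\mathrm{nr}}$ non-real zeros and $N^+$ positive zeros. Then for $\alpha>-1$: (1) $N^{\mathrm{nr}}=0$ if and only if $q_n$ has only real zeros for all $n\ge0$. Moreover, in that case the zeros of $q_n$ are simple, the zeros of $q_{n+1}$ interlace the zeros of $q_n$, and for $n$ big enough $q_n$ has exactly $N^+$ negative zeros. (2) If $N^{\mathrm{nr}}>0$ then there exists $n_0$ such that for $n\ge n_0$ the polynomial $q_n$ has exactly $n-N^{\mathrm{nr}}$ real zeros, of which $N^+$ are negative. If $\alpha\ge0$, then (for $n\ge n_0$) the real zeros of $q_{n+1}$ interlace the real zeros of $q_n$.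
   Context: $L_n^\alpha(x)=\sum_{j=0}^n\binom{n+\alpha}{n-j}\frac{(-x)^j}{j!}$ is the Laguerre polynomial, $(u)_s=u(u+1)\cdots(u+s-1)$, and $\mathfrak L_n^\alpha(x)=\frac{1}{(1+\alpha)_n}L_n^\alpha(x)$. Equivalently, the $q_n$, $n\ge 0$, are defined by the generating function $\sum_{n\ge0}q_n(x)z^n=e^{z}z^KP(1/z)\,{}_0F_1(-;\alpha+1;-xz)$. Zeros of $P$ are counted with multiplicity. Interlacing: given two finite sets $U,V$ of real numbers ordered by size, $U$ strictly interlaces $V$ if $\min U<\min V$ and between any two consecutive elements of any of the two sets there exists one element of the other. If $U\cap V=W\ne\emptyset$, then $U$ interlaces $V$ if $U\setminus W$ strictly interlaces $V\setminus W$; if $U\cap V=\emptyset$, $U$ interlaces $V$ means that it strictly interlaces $V$. *)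

theory Defs
  imports "HOL-Computational_Algebra.Computational_Algebra" Complex_Main
begin

definition laguerre :: "real \<Rightarrow> nat \<Rightarrow> real poly" where
  "laguerre \<alpha> n =
     (\<Sum>j\<le>n. smult (((real n + \<alpha>) gchoose (n - j)) / fact j) ([:0, -1:] ^ j))"

definition nlaguerre :: "real \<Rightarrow> nat \<Rightarrow> real poly" where
  "nlaguerre \<alpha> n = smult (1 / pochhammer (1 + \<alpha>) n) (laguerre \<alpha> n)"

definition gamma_poly :: "nat \<Rightarrow> (nat \<Rightarrow> real) \<Rightarrow> real poly" where
  "gamma_poly K \<gamma> = (\<Sum>j\<le>K. monom (\<gamma> j) (K - j))"

definition laguerre_comb :: "nat \<Rightarrow> (nat \<Rightarrow> real) \<Rightarrow> real \<Rightarrow> nat \<Rightarrow> real poly" where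
  "laguerre_comb K \<gamma> \<alpha> n =
     (\<Sum>j\<le>min n K. smult (\<gamma> j) (nlaguerre \<alpha> (n - j)))"

text \<open>
  The complex zeros of a real polynomial, repeated according to multiplicity. The library sets
  \<open>proots 0 = {#}\<close>; every polynomial this is applied to below is nonzero.
\<close>

definition czeros :: "real poly \<Rightarrow> complex multiset" where
  "czeros p = proots (map_poly complex_of_real p)"

definition num_zeros_in :: "complex set \<Rightarrow> real poly \<Rightarrow> nat" where
  "num_zeros_in S p = size {#z \<in># czeros p. z \<in> S#}"

text \<open>The set of real zeros, without multiplicity, as interlacing is a relation between sets.\<close>

definition real_zeros :: "real poly \<Rightarrow> real set" where
  "real_zeros p = {x. poly p x = 0}"

abbreviation pos_reals :: "complex set" where
  "pos_reals \<equiv> complex_of_real ` {0<..}"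

abbreviation neg_reals :: "complex set" where
  "neg_reals \<equiv> complex_of_real ` {..<0}"

text \<open>Some point of \<open>B\<close> lies between any two consecutive elements of \<open>A\<close>.\<close>

definition separates :: "real set \<Rightarrow> real set \<Rightarrow> bool" where
  "separates B A \<longleftrightarrow>
     (\<forall>x\<in>A. \<forall>y\<in>A. x < y \<and> A \<inter> {x<..<y} = {} \<longrightarrow> B \<inter> {x<..<y} \<noteq> {})"

text \<open>
  \<open>Min {}\<close> is unspecified in HOL. The minimum of the empty set is read as \<open>+\<infinity>\<close> here, so a
  singleton strictly interlaces the empty set; this case occurs for the zeros of the constant
  polynomial \<open>q\<^sub>0\<close>.
\<close>

definition strictly_interlaces :: "real set \<Rightarrow> real set \<Rightarrow> bool" where
  "strictly_interlaces U V \<longleftrightarrow>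
     finite U \<and> finite V \<and> U \<noteq> {} \<and> (V \<noteq> {} \<longrightarrow> Min U < Min V) \<and>
     separates V U \<and> separates U V"

definition interlaces :: "real set \<Rightarrow> real set \<Rightarrow> bool" where
  "interlaces U V \<longleftrightarrow> strictly_interlaces (U - U \<inter> V) (V - U \<inter> V)"

end

theory Submission
  imports Defs "HOL-Complex_Analysis.Residue_Theorem"
begin

text \<open>
  Put $Q(t) = t^K P(1/t)$ and $r_n = Q(D)\,y^n/n!$. The $r_n$ form an Appell sequence,
  $r_{n+1}' = r_n$, and $q_n(x)$ arises from $r_n(1-x)$ when the coefficient of $x^i$ is divided
  by $(1+\alpha)_i$. The same division with $n-K$ in the place of $\alpha$ turns $P$ into $r_n$, up
  to the factor $y^{n-K}/(n-K)!$. So two applications of one operator lead from $P$ to $q_n$, and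
  the question is what this operator does to the zeros.

  It does not increase the number of non-real zeros, and it decreases neither the number of positive
  nor the number of negative ones (\<open>gamma_multiplier_zeros\<close>, going back to Laguerre). The reason is
  that splitting off a real zero $\theta$ of $f$ expresses the image of $f$ through the
  derivative of $e^{-x/\theta} x^{1+\alpha} u(x)$, where $u$ is the image of $f/(x-\theta)$ under
  the operator for $\alpha+1$; then Rolle's theorem applies. Keeping track of the multiplicities
  gives more: if the number of real zeros is exactly preserved, all real zeros of the
  image, except perhaps $0$, are simple. Hence $q_n$ has at most $N^{\mathrm{nr}}$ non-real zeros
  (for $n \ge K$; if $P$ is real-rooted, the Appell property and Rolle's theorem carry this down
  to $n < K$).

  Conversely, for large $n$ there are at least $N^{\mathrm{nr}}$ non-real zeros: after the
  substitution $x = -n^2 w$ and division by the leading term, $q_n$ converges to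
  $e^{1/w} P(w)/w^K$ away from $w = 0$, and Rouche's theorem on a disc in the upper and one in
  the lower half-plane transfers the non-real zeros of $P$ to $q_n$
  (\<open>laguerre_appell_nonreal_ge\<close>). The polynomial $q_{n+1} + c\,q_n$ belongs to $(x+c)P(x)$ as $q_n$
  belongs to $P$, and the estimate is uniform in $c \in \mathbb{R}$. Thus, from some $n$ on, every
  member of these pencils has exactly $N^{\mathrm{nr}}$ non-real zeros.

  The rest is a consequence of this exactness. Positive zeros of $P$ become zeros of $r_n$ in
  $(0,\infty)$, eventually in $(1,\infty)$, and these become the negative zeros of $q_n$. Since the
  real zeros $x \ne 0$ of $q_n$ and of all $q_{n+1} + c\,q_n$ are simple, the Wronskian of $q_{n+1}$ and $q_n$ has no
  zero except perhaps $0$; its degree is even and its leading coefficient negative, so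
  $q_{n+1}/q_n$ decreases between its poles, and this is interlacing
  (\<open>interlaces_of_simple_pencil\<close>).
\<close>

section \<open>Counting zeros with multiplicity\<close>

text \<open>
  Zeros in $I$ counted with multiplicity. The definition is generic so that real polynomials and their
  complexifications are counted in the same way.
\<close>
definition zcount :: "'a::idom set \<Rightarrow> 'a poly \<Rightarrow> nat" where
  "zcount I f = size {#x \<in># proots f. x \<in> I#}"

lemma zcount_eq_sum:
  assumes "f \<noteq> 0" "finite A" "A \<subseteq> I" "{x \<in> I. poly f x = 0} \<subseteq> A"
  shows "zcount I f = (\<Sum>x\<in>A. order x f)"
proof -
  have "zcount I f = (\<Sum>x\<in>{x \<in> I. poly f x = 0}. order x f)"
    using assms(1) unfolding zcount_def size_multiset_overloaded_eq
    by (intro sum.cong) auto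
  also have "\<dots> = (\<Sum>x\<in>A. order x f)"
    using assms by (intro sum.mono_neutral_left) (auto simp: order_root)
  finally show ?thesis .
qed

lemma zcount_mult: "f * g \<noteq> 0 \<Longrightarrow> zcount I (f * g) = zcount I f + zcount I g"
  by (simp add: zcount_def proots_mult)

lemma zcount_smult [simp]: "c \<noteq> 0 \<Longrightarrow> zcount I (smult c f) = zcount I f"
  by (simp add: zcount_def)

lemma zcount_linear [simp]: "zcount I [:-a, 1:] = (if a \<in> I then 1 else 0)"
  by (simp add: zcount_def)

lemma zcount_Un: "I \<inter> J = {} \<Longrightarrow> zcount (I \<union> J) f = zcount I f + zcount J f"
  unfolding zcount_def size_union[symmetric]
  by (rule arg_cong[where f = size], rule multiset_eqI) auto

lemma zcount_le_degree: "zcount I f \<le> degree f"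
  unfolding zcount_def
  by (rule order_trans[OF size_mset_mono[OF multiset_filter_subset] size_proots_le])

lemma zcount_mono: "I \<subseteq> J \<Longrightarrow> zcount I f \<le> zcount J f"
  using zcount_Un[of I "J - I" f] by (simp add: Un_absorb1)

lemma zcount_UNIV_complex: "zcount UNIV (f :: complex poly) = degree f"
  by (simp add: zcount_def size_proots_complex)

lemma zcount_singleton: "f \<noteq> 0 \<Longrightarrow> zcount {x} f = order x f"
  by (subst zcount_eq_sum[where A = "{x}"]) auto

lemma zcount_UNIV_real:
  fixes f :: "real poly"
  assumes "f \<noteq> 0"
  shows "zcount UNIV f = zcount {0<..} f + zcount {..<0} f + order 0 f"
proof -
  have "UNIV = ({0<..} \<union> {..<0}) \<union> {0::real}" by auto
  moreover have "zcount (({0<..} \<union> {..<0}) \<union> {0}) f = zcount {0<..} f + zcount {..<0} f + zcount {0} f"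
    by (subst zcount_Un, force, subst zcount_Un) auto
  ultimately show ?thesis using zcount_singleton[OF assms, of 0] by metis
qed

lemma order_eqI:
  fixes q :: "'a::idom poly"
  assumes "p = smult k ([:-x, 1:] ^ n * q)" "k \<noteq> 0" "poly q x \<noteq> 0"
  shows "order x p = n"
proof -
  have "q \<noteq> 0" using assms by auto
  then show ?thesis
    using assms by (simp add: order_smult order_mult order_power_n_n order_0I)
qed

lemma order_pcompose_linear:
  fixes p :: "'a::field poly"
  assumes "p \<noteq> 0" "b \<noteq> 0"
  shows "order x (pcompose p [:a, b:]) = order (a + b * x) p"
proof -
  define c where "c = a + b * x"
  obtain q where q: "p = [:-c, 1:] ^ order c p * q" "\<not> [:-c, 1:] dvd q"
    using order_decomp[OF assms(1)] by blast
  have pow: "pcompose ([:-c, 1:] ^ n) [:a, b:] = smult (b ^ n) ([:-x, 1:] ^ n)" for n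
  proof (induction n)
    case (Suc n)
    have lin: "pcompose [:-c, 1:] [:a, b:] = smult b [:-x, 1:]"
      by (simp add: pcompose_pCons c_def)
    show ?case
      unfolding power_Suc pcompose_mult lin Suc.IH mult_smult_left mult_smult_right smult_smult
      by (simp only: mult_ac)
  qed (simp add: pcompose_1)
  have "pcompose p [:a, b:] = smult (b ^ order c p) ([:-x, 1:] ^ order c p * pcompose q [:a, b:])"
    by (subst q(1)) (simp add: pcompose_mult pow)
  moreover have "poly (pcompose q [:a, b:]) x \<noteq> 0"
    using q(2) by (simp add: poly_pcompose dvd_iff_poly_eq_0 c_def mult.commute add.commute)
  ultimately show ?thesis using assms(2) by (auto intro!: order_eqI simp: c_def)
qed

lemma pcompose_linear_nonzero:
  fixes p :: "'a::field poly"
  assumes "p \<noteq> 0" "b \<noteq> 0" shows "pcompose p [:a, b:] \<noteq> 0"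
  using assms pcompose_eq_0[of p "[:a, b:]"] by auto

lemma zcount_pcompose_linear:
  fixes p :: "'a::field poly"
  assumes "p \<noteq> 0" "b \<noteq> 0"
  shows "zcount I (pcompose p [:a, b:]) = zcount ((\<lambda>x. a + b * x) ` I) p"
proof -
  let ?h = "\<lambda>x. a + b * x" and ?r = "pcompose p [:a, b:]"
  let ?A = "{x \<in> I. poly ?r x = 0}"
  have nz: "?r \<noteq> 0" using assms by (rule pcompose_linear_nonzero)
  have fin: "finite ?A"
    by (rule finite_subset[OF _ poly_roots_finite[OF nz]]) auto
  have "zcount (?h ` I) p = (\<Sum>y\<in>?h ` ?A. order y p)"
    using assms(1) fin by (intro zcount_eq_sum) (auto simp: poly_pcompose mult.commute)
  also have "\<dots> = (\<Sum>x\<in>?A. order (?h x) p)"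
    using assms(2) by (subst sum.reindex) (auto simp: inj_on_def)
  also have "\<dots> = (\<Sum>x\<in>?A. order x ?r)"
    using assms by (simp add: order_pcompose_linear)
  also have "\<dots> = zcount I ?r"
    using nz fin by (intro zcount_eq_sum[symmetric]) auto
  finally show ?thesis by simp
qed

lemma map_poly_of_real_mult:
  "map_poly of_real (p * q) = (map_poly of_real p * map_poly of_real q :: complex poly)"
  by (rule poly_eqI) (simp add: coeff_map_poly coeff_mult)

lemma map_poly_of_real_power:
  "map_poly of_real (p ^ n) = (map_poly of_real p ^ n :: complex poly)"
  by (induction n) (auto simp: map_poly_of_real_mult)

lemma poly_map_poly_of_real: "poly (map_poly of_real p) (of_real x) = (of_real (poly p x) :: complex)"
  by (induction p) (auto simp: map_poly_pCons)

lemma order_map_poly_of_real: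
  assumes "p \<noteq> 0"
  shows "order (complex_of_real x) (map_poly complex_of_real p) = order x p"
proof -
  obtain q where q: "p = [:-x, 1:] ^ order x p * q" "\<not> [:-x, 1:] dvd q"
    using order_decomp[OF assms(1)] by blast
  have "map_poly complex_of_real p =
      smult 1 ([:-complex_of_real x, 1:] ^ order x p * map_poly complex_of_real q)"
    by (subst q(1)) (simp add: map_poly_of_real_mult map_poly_of_real_power map_poly_pCons)
  moreover have "poly (map_poly complex_of_real q) (complex_of_real x) \<noteq> 0"
    using q(2) by (simp add: poly_map_poly_of_real dvd_iff_poly_eq_0)
  ultimately show ?thesis by (rule order_eqI[OF _ one_neq_zero])
qed

lemma zcount_map_poly_of_real:
  assumes "p \<noteq> 0"
  shows "zcount (complex_of_real ` I) (map_poly complex_of_real p) = zcount I p"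
proof -
  let ?A = "{x \<in> I. poly p x = 0}"
  have fin: "finite ?A"
    by (rule finite_subset[OF _ poly_roots_finite[OF assms]]) auto
  have nz: "map_poly complex_of_real p \<noteq> 0"
    using assms by (simp add: map_poly_eq_0_iff)
  have "zcount (complex_of_real ` I) (map_poly complex_of_real p) =
      (\<Sum>z\<in>complex_of_real ` ?A. order z (map_poly complex_of_real p))"
    using nz fin by (intro zcount_eq_sum) (auto simp: poly_map_poly_of_real)
  also have "\<dots> = (\<Sum>x\<in>?A. order x p)"
    by (subst sum.reindex) (auto simp: inj_on_def order_map_poly_of_real[OF assms])
  also have "\<dots> = zcount I p"
    using assms fin by (intro zcount_eq_sum[symmetric]) auto
  finally show ?thesis .
qed

lemma num_zeros_in_eq_zcount: "num_zeros_in S p = zcount S (map_poly complex_of_real p)"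
  by (simp add: num_zeros_in_def czeros_def zcount_def)

lemma num_nonreal:
  assumes "p \<noteq> 0"
  shows "num_zeros_in (- \<real>) p + zcount UNIV p = degree p"
proof -
  have "zcount UNIV p = zcount \<real> (map_poly complex_of_real p)"
    using zcount_map_poly_of_real[OF assms, of UNIV] by (simp add: Reals_def)
  then have "num_zeros_in (- \<real>) p + zcount UNIV p = zcount (- \<real> \<union> \<real>) (map_poly complex_of_real p)"
    by (subst zcount_Un) (auto simp: num_zeros_in_eq_zcount)
  also have "- \<real> \<union> \<real> = (UNIV :: complex set)" by auto
  finally show ?thesis by (simp add: zcount_UNIV_complex degree_map_poly)
qed

section \<open>Rolle's theorem with multiplicities\<close>

text \<open>
  If the order drops by one at each zero of $f$, as for a derivative, then passing from $f$ to $v$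
  loses as many zeros as $f$ has distinct ones, and gains the zeros of $v$ that are not zeros
  of $f$.
\<close>
lemma zcount_accounting:
  fixes f v :: "real poly"
  assumes "f \<noteq> 0" "v \<noteq> 0"
    and "\<And>x. x \<in> I \<Longrightarrow> poly f x = 0 \<Longrightarrow> order x f = Suc (order x v)"
  defines "Z \<equiv> {x \<in> I. poly f x = 0}"
    and "S \<equiv> {x \<in> I. poly v x = 0 \<and> poly f x \<noteq> 0}"
  shows "zcount I v + card Z = zcount I f + (\<Sum>x\<in>S. order x v)"
proof -
  have fin: "finite Z" "finite S"
    unfolding Z_def S_def
    by (rule finite_subset[OF _ poly_roots_finite[OF assms(1)]], blast)
       (rule finite_subset[OF _ poly_roots_finite[OF assms(2)]], blast)
  have "zcount I v = (\<Sum>x\<in>Z \<union> S. order x v)"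
    using assms(2) fin by (intro zcount_eq_sum) (auto simp: Z_def S_def)
  also have "\<dots> = (\<Sum>x\<in>Z. order x v) + (\<Sum>x\<in>S. order x v)"
    using fin by (intro sum.union_disjoint) (auto simp: Z_def S_def)
  finally have "zcount I v + card Z = (\<Sum>x\<in>Z. Suc (order x v)) + (\<Sum>x\<in>S. order x v)"
    by (simp only: sum_Suc)
  also have "(\<Sum>x\<in>Z. Suc (order x v)) = (\<Sum>x\<in>Z. order x f)"
    using assms(3) by (intro sum.cong) (auto simp: Z_def)
  also have "\<dots> = zcount I f"
    using assms(1) fin by (intro zcount_eq_sum[symmetric]) (auto simp: Z_def)
  finally show ?thesis .
qed

text \<open>
  How Rolle's theorem is used below: it supplies enough distinct new zeros, up to a defect $d$ and
  a surplus $e$. When the resulting bound is attained there is no room for a multiple new zero,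
  so that every multiple zero of $v$ comes from a zero of $f$ of order one higher.
\<close>
lemma zcount_rolle:
  fixes f v :: "real poly"
  assumes "f \<noteq> 0" "v \<noteq> 0"
    and "\<And>x. x \<in> I \<Longrightarrow> poly f x = 0 \<Longrightarrow> order x f = Suc (order x v)"
    and "card {x \<in> I. poly f x = 0} + e \<le> card {x \<in> I. poly v x = 0 \<and> poly f x \<noteq> 0} + d"
  shows "zcount I f + e \<le> zcount I v + d"
    and "zcount I f + e = zcount I v + d \<Longrightarrow> x \<in> I \<Longrightarrow> order x v \<ge> 2 \<Longrightarrow> order x f = Suc (order x v)"
proof -
  define S where "S = {x \<in> I. poly v x = 0 \<and> poly f x \<noteq> 0}"
  have fin: "finite S"
    unfolding S_def by (rule finite_subset[OF _ poly_roots_finite[OF assms(2)]]) auto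
  have eq: "zcount I v + card {x \<in> I. poly f x = 0} = zcount I f + (\<Sum>x\<in>S. order x v)"
    unfolding S_def by (rule zcount_accounting) (use assms in auto)
  have ge1: "1 \<le> order x v" if "x \<in> S" for x
    using that assms(2) by (auto simp: S_def order_root Suc_le_eq)
  have card: "card S \<le> (\<Sum>x\<in>S. order x v)"
    using sum_mono[of S "\<lambda>_. 1" "\<lambda>x. order x v"] ge1 by simp
  show "zcount I f + e \<le> zcount I v + d"
    using eq card assms(4) by (simp add: S_def)
  assume *: "zcount I f + e = zcount I v + d" "x \<in> I" "order x v \<ge> 2"
  have "x \<notin> S"
  proof
    assume "x \<in> S"
    then have "(\<Sum>x\<in>S. 1) < (\<Sum>x\<in>S. order x v)"
      using ge1 *(3) fin \<open>x \<in> S\<close> by (intro sum_strict_mono_ex1) (auto intro!: bexI[of _ x])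
    then show False using eq *(1) assms(4) by (simp add: S_def)
  qed
  moreover have "poly v x = 0" using *(3) by (auto simp: order_root)
  ultimately have "poly f x = 0" using *(2) by (auto simp: S_def)
  with *(2) assms(3) show "order x f = Suc (order x v)" by blast
qed

lemma card_le_separated:
  fixes Z S :: "real set"
  assumes "finite Z" "finite S" "Z \<noteq> {}"
    and "\<And>x y. x \<in> Z \<Longrightarrow> y \<in> Z \<Longrightarrow> x < y \<Longrightarrow> \<exists>s\<in>S. x < s \<and> s < y"
  shows "card Z \<le> Suc (card {s \<in> S. s < Max Z})"
  using assms(1,3,4)
proof (induction rule: finite_linorder_max_induct)
  case (insert b A)
  show ?case
  proof (cases "A = {}")
    case False
    have M: "Max A \<in> A" "Max A < b"
      using insert(1,2) False by simp_all
    from M have M': "b = Max (insert b A)"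
      using insert(1,2) False by (intro Max_eqI[symmetric]) (auto intro: less_imp_le)
    then obtain s where s: "s \<in> S" "Max A < s" "s < b"
      using insert(5)[of "Max A" b] M by blast
    have "card A \<le> Suc (card {s \<in> S. s < Max A})"
      using insert False by auto
    moreover have "Suc (card {s \<in> S. s < Max A}) = card (insert s {s \<in> S. s < Max A})"
      using s assms(2) by (subst card_insert_disjoint) auto
    moreover have "card (insert s {s \<in> S. s < Max A}) \<le> card {s \<in> S. s < b}"
      using s M assms(2) by (intro card_mono) auto
    moreover have "card (insert b A) = Suc (card A)" using insert by auto
    ultimately show ?thesis using M' by simp
  qed simp
qed simp

text \<open>
  Rolle's theorem with the extra information that the critical point is not a zero of the function:
  it is chosen where $F^2$ is maximal. So $a$ and $b$ may be any two zeros, and the zeros of the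
  derivative found in this way are distinct from those of $F$.
\<close>
lemma rolle_off_zeros:
  fixes F F' :: "real \<Rightarrow> real"
  assumes "a < b" "continuous_on {a..b} F" "F a = 0" "F b = 0" "z \<in> {a<..<b}" "F z \<noteq> 0"
    and "\<And>x. x \<in> {a<..<b} \<Longrightarrow> (F has_real_derivative F' x) (at x)"
  obtains s where "a < s" "s < b" "F s \<noteq> 0" "F' s = 0"
proof -
  have "\<exists>s\<in>{a..b}. \<forall>x\<in>{a..b}. (F x)\<^sup>2 \<le> (F s)\<^sup>2"
    using assms(1,2) by (intro continuous_attains_sup continuous_intros) auto
  then obtain s where s: "s \<in> {a..b}" "\<And>x. x \<in> {a..b} \<Longrightarrow> (F x)\<^sup>2 \<le> (F s)\<^sup>2" by blast
  have "0 < (F z)\<^sup>2" using assms(6) by simp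
  also have "\<dots> \<le> (F s)\<^sup>2" using assms(5) by (intro s) auto
  finally have Fs: "F s \<noteq> 0" by auto
  then have "s \<noteq> a" "s \<noteq> b" using assms by auto
  then have sab: "s \<in> {a<..<b}" using s(1) by auto
  have "((\<lambda>x. (F x)\<^sup>2) has_real_derivative 2 * F s * F' s) (at s)"
    using assms(7)[OF sab] by (auto intro!: derivative_eq_intros)
  then have "2 * F s * F' s = 0"
  proof (rule DERIV_local_max)
    show "0 < min (s - a) (b - s)" using sab by auto
    show "\<forall>y. \<bar>s - y\<bar> < min (s - a) (b - s) \<longrightarrow> (F y)\<^sup>2 \<le> (F s)\<^sup>2"
      using s(2) by (auto simp: abs_if split: if_splits)
  qed
  with Fs sab that show ?thesis by auto
qed

lemma poly_nonzero_point:
  fixes u :: "real poly"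
  assumes "u \<noteq> 0" "a < b"
  obtains z where "a < z" "z < b" "poly u z \<noteq> 0"
proof -
  have "\<not> {a<..<b} \<subseteq> {x. poly u x = 0}"
    using poly_roots_finite[OF assms(1)] assms(2) infinite_Ioo finite_subset by blast
  then show ?thesis using that unfolding subset_iff greaterThanLessThan_iff mem_Collect_eq by blast
qed

section \<open>The multiplier sequence of reciprocal rising factorials\<close>

text \<open>
  Since $(1+a)_i = \Gamma(1+a+i)/\Gamma(1+a)$, this is the multiplier sequence $1/\Gamma(1+a+i)$, normalised to
  be $1$ at $i = 0$.
\<close>
definition gamma_multiplier :: "real \<Rightarrow> real poly \<Rightarrow> real poly" where
  "gamma_multiplier a f = (\<Sum>i\<le>degree f. monom (coeff f i / pochhammer (1 + a) i) i)"

lemma coeff_gamma_multiplier: "coeff (gamma_multiplier a f) i = coeff f i / pochhammer (1 + a) i"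
  by (auto simp: gamma_multiplier_def coeff_sum coeff_eq_0)

lemma pochhammer_1_pos: "a > -1 \<Longrightarrow> pochhammer (1 + a) i > (0::real)"
  by (intro pochhammer_pos) auto

lemma degree_gamma_multiplier:
  assumes "a > -1" shows "degree (gamma_multiplier a f) = degree f"
proof (rule antisym)
  show "degree (gamma_multiplier a f) \<le> degree f"
    by (rule degree_le) (simp add: coeff_gamma_multiplier coeff_eq_0)
  show "degree f \<le> degree (gamma_multiplier a f)"
    using pochhammer_1_pos[OF assms]
    by (cases "f = 0") (auto intro!: le_degree simp: coeff_gamma_multiplier less_imp_neq[symmetric])
qed

lemma gamma_multiplier_eq_0_iff:
  assumes "a > -1" shows "gamma_multiplier a f = 0 \<longleftrightarrow> f = 0"
  using pochhammer_1_pos[OF assms]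
  by (auto simp: poly_eq_iff coeff_gamma_multiplier less_imp_neq[symmetric])

text \<open>
  For $x > 0$ and $\theta \ne 0$ the value at $x$ is the derivative of $e^{-x/\theta} x^b u(x)$,
  divided by $-\theta^{-1} e^{-x/\theta} x^{b-1}$. In the polynomial form $\theta = 0$ is allowed,
  where the step is multiplication by $x$.
\<close>
definition rolle_step :: "real \<Rightarrow> real \<Rightarrow> real poly \<Rightarrow> real poly" where
  "rolle_step b \<theta> u = pCons 0 u - smult \<theta> (pCons 0 (pderiv u) + smult b u)"

lemma poly_rolle_step:
  "poly (rolle_step b \<theta> u) x = (x - \<theta> * b) * poly u x - \<theta> * x * poly (pderiv u) x"
  by (simp add: rolle_step_def algebra_simps)

text \<open>
  The recursion behind everything: the image of $(x-\theta) h$ is one Rolle step applied to the image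
  of $h$ under the operator with the next parameter. It rests on
  $(1+a)_{i+1} = (1+a)\,(2+a)_i$.
\<close>
lemma gamma_multiplier_linear_factor:
  assumes "a > -1"
  shows "smult (1 + a) (gamma_multiplier a ([:-\<theta>, 1:] * h)) =
         rolle_step (1 + a) \<theta> (gamma_multiplier (a + 1) h)"
proof (rule poly_eqI)
  fix i
  have p: "pochhammer (2 + a) j > 0" for j using assms by (intro pochhammer_pos) auto
  show "coeff (smult (1 + a) (gamma_multiplier a ([:-\<theta>, 1:] * h))) i =
        coeff (rolle_step (1 + a) \<theta> (gamma_multiplier (a + 1) h)) i"
  proof (cases i)
    case 0
    then show ?thesis by (simp add: rolle_step_def coeff_gamma_multiplier)
  next
    case (Suc j)
    have 1: "pochhammer (1 + a) (Suc j) = (1 + a) * pochhammer (2 + a) j"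
      by (simp add: pochhammer_rec)
    have 2: "pochhammer (2 + a) (Suc j) = (2 + a + real j) * pochhammer (2 + a) j"
      by (simp add: pochhammer_rec')
    have 3: "1 + (a + 1) = 2 + a" by simp
    define c where "c = 2 + a + real j"
    define Y where "Y = pochhammer (2 + a) j"
    define X where "X = coeff h (Suc j) / (c * Y)"
    have c: "c > 0" and Y: "Y > 0" using assms p by (auto simp: c_def Y_def)
    have "coeff (smult (1 + a) (gamma_multiplier a ([:-\<theta>, 1:] * h))) i =
        (coeff h j - \<theta> * coeff h (Suc j)) / Y"
      using assms Y unfolding Suc by (simp add: coeff_gamma_multiplier 1 Y_def[symmetric])
    also have "\<dots> = coeff h j / Y - \<theta> * (c * X)"
      using c Y by (simp add: X_def field_simps)
    also have "\<dots> = coeff (rolle_step (1 + a) \<theta> (gamma_multiplier (a + 1) h)) i"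
    proof -
      have "coeff (gamma_multiplier (a + 1) h) j = coeff h j / Y"
        "coeff (gamma_multiplier (a + 1) h) (Suc j) = X"
        by (simp_all only: coeff_gamma_multiplier 2 3 X_def Y_def c_def)
      then show ?thesis
        unfolding Suc rolle_step_def by (simp add: coeff_pderiv c_def algebra_simps)
    qed
    finally show ?thesis .
  qed
qed

lemma lead_coeff_rolle_step:
  assumes "u \<noteq> 0"
  shows "degree (rolle_step b \<theta> u) = Suc (degree u)" "lead_coeff (rolle_step b \<theta> u) = lead_coeff u"
proof -
  have c: "coeff (rolle_step b \<theta> u) (Suc (degree u)) = lead_coeff u"
    by (simp add: rolle_step_def coeff_pderiv coeff_eq_0)
  have "degree (rolle_step b \<theta> u) \<le> Suc (degree u)"
  proof (intro degree_le allI impI)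
    fix i assume "Suc (degree u) < i"
    then show "coeff (rolle_step b \<theta> u) i = 0"
      by (cases i) (simp_all add: rolle_step_def coeff_pderiv coeff_eq_0)
  qed
  with c assms show d: "degree (rolle_step b \<theta> u) = Suc (degree u)"
    by (intro antisym le_degree) auto
  then show "lead_coeff (rolle_step b \<theta> u) = lead_coeff u" using c by simp
qed

lemma rolle_step_nonzero: "u \<noteq> 0 \<Longrightarrow> rolle_step b \<theta> u \<noteq> 0"
  using lead_coeff_rolle_step(1)[of u b \<theta>] by (metis degree_0 nat.distinct(1))

lemma order_rolle_step:
  assumes "u \<noteq> 0" "\<theta> \<noteq> 0" "x \<noteq> 0" "poly u x = 0"
  shows "order x u = Suc (order x (rolle_step b \<theta> u))"
proof -
  define k where "k = order x (pderiv u)"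
  have k: "order x u = Suc k"
    unfolding k_def using assms by (intro order_pderiv) (auto simp: order_root)
  have du: "pderiv u \<noteq> 0"
    using assms(1,4) by (metis degree_eq_zeroE pderiv_eq_0_iff poly_const_conv pCons_eq_0_iff)
  obtain r where r: "pderiv u = [:-x, 1:] ^ k * r" "\<not> [:-x, 1:] dvd r"
    using order_decomp[OF du] unfolding k_def by blast
  obtain s where s: "u = [:-x, 1:] ^ Suc k * s"
    using order_decomp[OF assms(1)] k by metis
  define w where "w = [:-\<theta> * b, 1:] * ([:-x, 1:] * s) - [:0, \<theta>:] * r"
  have "rolle_step b \<theta> u = [:-\<theta> * b, 1:] * u - [:0, \<theta>:] * pderiv u"
    by (rule poly_eq_poly_eq_iff[THEN iffD1], rule ext) (simp add: poly_rolle_step algebra_simps)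
  also have "\<dots> = smult 1 ([:-x, 1:] ^ k * w)"
    unfolding r(1) w_def by (subst s) (simp only: power_Suc smult_1_left ring_distribs mult_ac)
  finally have "order x (rolle_step b \<theta> u) = k"
    using assms r(2) by (elim order_eqI) (auto simp: w_def dvd_iff_poly_eq_0)
  with k show ?thesis by simp
qed

lemma rolle_step_between:
  assumes "u \<noteq> 0" "b > 0" "\<theta> \<noteq> 0" "0 \<le> x" "x < y" "x = 0 \<or> poly u x = 0" "poly u y = 0"
  shows "\<exists>s. x < s \<and> s < y \<and> poly (rolle_step b \<theta> u) s = 0 \<and> poly u s \<noteq> 0"
proof -
  let ?F = "\<lambda>t. exp (- t / \<theta>) * t powr b * poly u t"
  let ?F' = "\<lambda>t. - (1 / \<theta>) * exp (- t / \<theta>) * t powr (b - 1) * poly (rolle_step b \<theta> u) t"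
  obtain z where z: "x < z" "z < y" "poly u z \<noteq> 0"
    using poly_nonzero_point assms by blast
  show ?thesis
  proof (rule rolle_off_zeros[of x y ?F z ?F'])
    show "x < y" "?F x = 0" "?F y = 0" "z \<in> {x<..<y}" "?F z \<noteq> 0"
      using assms z by auto
    show "continuous_on {x..y} ?F"
      using assms by (intro continuous_intros continuous_on_powr') auto
    fix t assume "t \<in> {x<..<y}"
    then have t: "t > 0" using assms by auto
    then have "t powr b = t powr (b - 1) * t"
      by (simp add: powr_diff)
    then show "(?F has_real_derivative ?F' t) (at t)"
      using t assms(3)
      by (auto intro!: derivative_eq_intros simp: poly_rolle_step field_simps)
  next
    fix s assume "x < s" "s < y" "?F s \<noteq> 0" "?F' s = 0"
    then show ?thesis using assms by (intro exI[of _ s]) auto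
  qed
qed

text \<open>
  To the right of the last zero $m$ the polynomial $u v$ would otherwise be positive, as it is near
  infinity where $u$ and $v$ have the same leading coefficient. Then the square of
  $e^{-x/\theta} x^b u(x)$ would decrease from its value $0$ at $m$.
\<close>
lemma rolle_step_beyond:
  assumes "u \<noteq> 0" "b > 0" "\<theta> > 0" "0 \<le> m" "m = 0 \<or> poly u m = 0" "\<And>y. y > m \<Longrightarrow> poly u y \<noteq> 0"
  shows "\<exists>s>m. poly (rolle_step b \<theta> u) s = 0"
proof (rule ccontr)
  assume none: "\<not> ?thesis"
  let ?v = "rolle_step b \<theta> u"
  let ?F = "\<lambda>t. (exp (- t / \<theta>) * t powr b * poly u t)\<^sup>2"
  let ?F' = "\<lambda>t. 2 * (exp (- t / \<theta>) * t powr b * poly u t) *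
                 (- (1 / \<theta>) * exp (- t / \<theta>) * t powr (b - 1) * poly ?v t)"
  have "lead_coeff (u * ?v) = (lead_coeff u)\<^sup>2"
    unfolding lead_coeff_mult lead_coeff_rolle_step(2)[OF assms(1)] by (rule power2_eq_square[symmetric])
  then have "lead_coeff (u * ?v) > 0" using assms(1) by simp
  then obtain B where B: "\<And>x. x \<ge> B \<Longrightarrow> poly (u * ?v) x > 0"
    using poly_pinfty_gt_lc[of "u * ?v"] by force
  have pos: "poly (u * ?v) t > 0" if "t > m" for t
  proof (rule ccontr)
    assume "\<not> ?thesis"
    moreover have "poly (u * ?v) t \<noteq> 0" using none that assms(6) by auto
    ultimately have neg: "poly (u * ?v) t < 0" by (simp only: not_less less_le) simp
    then have "t < max B (t + 1)" "poly (u * ?v) (max B (t + 1)) > 0" using B by auto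
    then obtain y where "t < y" "poly (u * ?v) y = 0"
      using poly_IVT_pos[OF _ neg] by blast
    then show False using none that assms(6)[of y] by auto
  qed
  have "?F (m + 1) < ?F m"
  proof (rule DERIV_neg_imp_decreasing_open[where f = ?F])
    show "continuous_on {m..m + 1} ?F"
      using assms by (intro continuous_intros continuous_on_powr') auto
    fix t assume t: "m < t" "t < m + 1"
    then have t0: "t > 0" using assms by auto
    then have "t powr b = t powr (b - 1) * t"
      by (simp add: powr_diff)
    then have "(?F has_real_derivative ?F' t) (at t)"
      using t0 assms(3)
      by (auto intro!: derivative_eq_intros simp: poly_rolle_step field_simps power2_eq_square)
    moreover have "?F' t < 0"
    proof -
      let ?C = "2 / \<theta> * exp (- t / \<theta>) * exp (- t / \<theta>) * t powr b * t powr (b - 1)"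
      have "?F' t = - (?C * poly (u * ?v) t)" by simp
      moreover have "?C * poly (u * ?v) t > 0"
        using pos[OF t(1)] assms(3) t0 by (intro mult_pos_pos) simp_all
      ultimately show ?thesis by linarith
    qed
    ultimately show "\<exists>y. (?F has_real_derivative y) (at t) \<and> y < 0" by blast
  qed simp
  moreover have "?F m = 0" using assms(2,5) by auto
  ultimately show False using zero_le_power2 by (metis not_less)
qed

text \<open>
  The function $e^{-x/\theta} x^b u(x)$ vanishes at the positive zeros of $u$ and, because of
  $b > 0$, also at $0$. This additional zero compensates the one that Rolle's theorem loses. For
  $\theta > 0$ the function also tends to $0$ at infinity, which yields one zero more.
\<close>
lemma zcount_pos_rolle_step:
  assumes "u \<noteq> 0" "b > 0" "\<theta> \<noteq> 0"
  defines "e \<equiv> (if \<theta> > 0 then 1 else 0)" and "v \<equiv> rolle_step b \<theta> u"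
  shows "zcount {0<..} u + e \<le> zcount {0<..} v"
    and "zcount {0<..} u + e = zcount {0<..} v \<Longrightarrow> x > 0 \<Longrightarrow> order x v \<ge> 2 \<Longrightarrow> order x u = Suc (order x v)"
proof -
  define Z where "Z = {x \<in> {0<..}. poly u x = 0}"
  define S where "S = {x \<in> {0<..}. poly v x = 0 \<and> poly u x \<noteq> 0}"
  have v0: "v \<noteq> 0" unfolding v_def by (rule rolle_step_nonzero) fact
  have finZ: "finite Z"
    unfolding Z_def by (rule finite_subset[OF _ poly_roots_finite[OF assms(1)]]) blast
  have finS: "finite S"
    unfolding S_def by (rule finite_subset[OF _ poly_roots_finite[OF v0]]) blast
  let ?M = "Max (insert 0 Z)"
  have M: "?M \<in> insert 0 Z" "?M \<ge> 0" using finZ by (intro Max_in Max_ge; simp)+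
  \<comment> \<open>The point 0 counts as a zero of the weighted function, so it joins the zeros of $u$.\<close>
  have "card (insert 0 Z) \<le> Suc (card {s \<in> S. s < ?M})"
  proof (rule card_le_separated)
    fix x y assume xy: "x \<in> insert 0 Z" "y \<in> insert 0 Z" "x < y"
    then have "\<exists>s. x < s \<and> s < y \<and> poly v s = 0 \<and> poly u s \<noteq> 0"
      unfolding v_def using assms by (intro rolle_step_between) (auto simp: Z_def)
    then obtain s where "x < s" "s < y" "poly v s = 0" "poly u s \<noteq> 0" by blast
    moreover have "0 \<le> x" using xy by (auto simp: Z_def)
    ultimately show "\<exists>s\<in>S. x < s \<and> s < y" by (intro bexI[of _ s]) (auto simp: S_def)
  qed (use finZ finS in auto)
  then have c: "card Z \<le> card {s \<in> S. s < ?M}"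
    using finZ by (simp add: Z_def)
  have card: "card Z + e \<le> card S"
  proof (cases "\<theta> > 0")
    case True
    have nz: "poly u y \<noteq> 0" if "y > ?M" for y
    proof
      assume "poly u y = 0"
      then have "y \<in> insert 0 Z" using that M(2) by (auto simp: Z_def)
      then have "y \<le> ?M" using finZ by (intro Max_ge) auto
      then show False using that by simp
    qed
    obtain s where s: "s > ?M" "poly v s = 0"
    proof -
      have "?M = 0 \<or> poly u ?M = 0" using M(1) unfolding Z_def by blast
      then have "\<exists>s>?M. poly v s = 0"
        unfolding v_def by (intro rolle_step_beyond assms(1,2) True M(2) nz)
      then show ?thesis using that by blast
    qed
    have "s > 0" using s(1) M(2) by linarith
    then have "s \<in> S" using s nz unfolding S_def by simp
    then have "card (insert s {s \<in> S. s < ?M}) \<le> card S"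
      using finS by (intro card_mono) auto
    moreover have "card (insert s {s \<in> S. s < ?M}) = Suc (card {s \<in> S. s < ?M})"
      using s finS by (subst card_insert_disjoint) auto
    ultimately show ?thesis using c by (simp add: e_def)
  next
    case False
    have "card {s \<in> S. s < ?M} \<le> card S" using finS by (intro card_mono) auto
    with c False show ?thesis by (simp add: e_def)
  qed
  have ord: "order x u = Suc (order x v)" if "x \<in> {0<..}" "poly u x = 0" for x
    unfolding v_def using assms that by (intro order_rolle_step) auto
  note rolle = zcount_rolle[OF assms(1) v0 ord, of "{0<..}" e 0, folded Z_def S_def]
  show "zcount {0<..} u + e \<le> zcount {0<..} v"
    using rolle(1) card by simp
  show "order x u = Suc (order x v)"
    if "zcount {0<..} u + e = zcount {0<..} v" "x > 0" "order x v \<ge> 2"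
    using rolle(2) card that by simp
qed

text \<open>
  The negative zeros are treated by reflection, which changes the sign of $\theta$.
\<close>
lemma rolle_step_reflect:
  "pcompose (rolle_step b \<theta> u) [:0, -1:] = - rolle_step b (-\<theta>) (pcompose u [:0, -1:])"
proof (rule poly_eq_poly_eq_iff[THEN iffD1], rule ext)
  fix x
  show "poly (pcompose (rolle_step b \<theta> u) [:0, -1:]) x = poly (- rolle_step b (-\<theta>) (pcompose u [:0, -1:])) x"
    by (simp add: poly_rolle_step poly_pcompose pderiv_pcompose pderiv_pCons algebra_simps)
qed

lemma zcount_neg_eq_pos:
  assumes "p \<noteq> (0 :: real poly)"
  shows "zcount {..<0} p = zcount {0<..} (pcompose p [:0, -1:])"
proof -
  have "(\<lambda>x::real. 0 + -1 * x) ` {0<..} = {..<0}"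
    by (auto simp: image_iff intro!: bexI[of _ "- x" for x])
  then show ?thesis using assms by (subst zcount_pcompose_linear) auto
qed

lemma zcount_neg_rolle_step:
  assumes "u \<noteq> 0" "b > 0" "\<theta> \<noteq> 0"
  defines "e \<equiv> (if \<theta> < 0 then 1 else 0)" and "v \<equiv> rolle_step b \<theta> u"
  shows "zcount {..<0} u + e \<le> zcount {..<0} v"
    and "zcount {..<0} u + e = zcount {..<0} v \<Longrightarrow> x < 0 \<Longrightarrow> order x v \<ge> 2 \<Longrightarrow> order x u = Suc (order x v)"
proof -
  let ?u = "pcompose u [:0, -1:]"
  let ?v = "rolle_step b (-\<theta>) ?u"
  have u0: "?u \<noteq> 0" using assms by (intro pcompose_linear_nonzero) auto
  have v0: "v \<noteq> 0" unfolding v_def by (rule rolle_step_nonzero) fact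
  have u: "zcount {..<0} u = zcount {0<..} ?u" by (rule zcount_neg_eq_pos) fact
  have "zcount {0<..} (- ?v) = zcount {0<..} ?v"
    by (simp add: zcount_def)
  then have v: "zcount {..<0} v = zcount {0<..} ?v"
    using zcount_neg_eq_pos[OF v0] by (simp add: v_def rolle_step_reflect)
  have ou: "order (- x) ?u = order x u" for x
    using order_pcompose_linear[OF assms(1), of "-1" "-x" 0] by simp
  have ov: "order (- x) ?v = order x v" for x
    using order_pcompose_linear[OF v0, of "-1" "-x" 0] by (simp add: v_def rolle_step_reflect)
  note step = zcount_pos_rolle_step[OF u0 assms(2), of "-\<theta>"]
  show "zcount {..<0} u + e \<le> zcount {..<0} v"
    using step(1) assms(3) by (simp add: u v e_def)
  show "order x u = Suc (order x v)"
    if "zcount {..<0} u + e = zcount {..<0} v" "x < 0" "order x v \<ge> 2"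
    using step(2)[of "-x"] that assms(3) by (simp add: u v e_def ou ov)
qed

text \<open>
  If $u = x^k r$ with $r(0) \ne 0$, then the step sends $x^k r$ to
  $x^k (x r - \theta ((k+b) r + x r'))$, and the second factor has the value
  $-\theta (k+b) r(0) \ne 0$ at $0$.
\<close>
lemma order_0_rolle_step:
  assumes "u \<noteq> 0" "b > 0" "\<theta> \<noteq> 0"
  shows "order 0 (rolle_step b \<theta> u) = order 0 u"
proof -
  define k where "k = order 0 u"
  define X :: "real poly" where "X = [:-0, 1:]"
  obtain r where r: "u = X ^ k * r" "\<not> X dvd r"
    using order_decomp[OF assms(1), of 0] unfolding k_def X_def by blast
  have X: "X * pderiv (X ^ k) = smult (real k) (X ^ k)"
  proof (cases k)
    case (Suc j)
    then show ?thesis by (simp only: pderiv_power_Suc) (simp add: X_def pderiv_pCons)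
  qed simp
  have "rolle_step b \<theta> u = X * u - smult \<theta> (X * pderiv u + smult b u)"
    by (simp add: rolle_step_def X_def)
  also have "X * pderiv u = smult (real k) (X ^ k) * r + X ^ k * (X * pderiv r)"
    by (simp only: r(1) pderiv_mult X[symmetric] ring_distribs mult_ac)
  also have "X * u - smult \<theta> (\<dots> + smult b u) =
      smult 1 (X ^ k * (X * r - smult \<theta> (smult (real k + b) r + X * pderiv r)))"
    by (simp add: r(1) algebra_simps smult_add_left smult_add_right)
  finally have "order 0 (rolle_step b \<theta> u) = k"
    unfolding X_def
    by (rule order_eqI) (use assms r(2) in \<open>auto simp: X_def dvd_iff_poly_eq_0\<close>)
  then show ?thesis by (simp add: k_def)
qed

text \<open>
  One real zero after the other is split off. A polynomial without real zeros
  contributes nothing to the left-hand sides, so the induction may stop there. The last clause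
  travels along: equality for $f$ forces equality in the Rolle step and for the cofactor $h$, so a
  multiple zero of the image of $f$ would be a multiple zero of the image of $h$, of higher order.
\<close>
lemma gamma_multiplier_zeros:
  assumes "f \<noteq> 0" "a > -1"
  shows "zcount {0<..} f \<le> zcount {0<..} (gamma_multiplier a f) \<and>
         zcount {..<0} f \<le> zcount {..<0} (gamma_multiplier a f) \<and>
         order 0 (gamma_multiplier a f) = order 0 f \<and>
         (zcount UNIV (gamma_multiplier a f) = zcount UNIV f \<longrightarrow>
            (\<forall>x. x \<noteq> 0 \<longrightarrow> order x (gamma_multiplier a f) \<le> 1))"
  using assms
proof (induction "degree f" arbitrary: f a rule: less_induct)
  case less
  note nz = gamma_multiplier_eq_0_iff[OF less.prems(2), of f]
  show ?case
  proof (cases "\<exists>\<theta>. poly f \<theta> = 0")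
    case False
    then have z: "zcount I f = 0" for I
      using less.prems(1) by (subst zcount_eq_sum[of _ "{}"]) auto
    have "poly (gamma_multiplier a f) 0 = poly f 0"
      by (simp add: poly_0_coeff_0 coeff_gamma_multiplier)
    then have "order 0 (gamma_multiplier a f) = order 0 f"
      using False by (simp add: order_0I)
    moreover have "order x (gamma_multiplier a f) = 0" if "zcount UNIV (gamma_multiplier a f) = 0" for x
      using that nz less.prems(1) zcount_mono[of "{x}" UNIV "gamma_multiplier a f"]
      by (simp add: zcount_singleton)
    ultimately show ?thesis by (auto simp: z)
  next
    case True
    then obtain \<theta> h where f: "f = [:-\<theta>, 1:] * h"
      by (auto simp: poly_eq_0_iff_dvd)
    then have h: "h \<noteq> 0" "degree h < degree f"
      using less.prems(1) by (auto simp: degree_mult_eq simp del: mult_pCons_left)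
    define u where "u = gamma_multiplier (a + 1) h"
    define v where "v = rolle_step (1 + a) \<theta> u"
    have u0: "u \<noteq> 0"
      unfolding u_def using h less.prems by (subst gamma_multiplier_eq_0_iff) auto
    have v0: "v \<noteq> 0" unfolding v_def by (rule rolle_step_nonzero) fact
    have v: "v = smult (1 + a) (gamma_multiplier a f)"
      unfolding v_def u_def f by (rule gamma_multiplier_linear_factor[symmetric]) (rule less.prems)
    have zv: "zcount I v = zcount I (gamma_multiplier a f)"
      and ov: "order x v = order x (gamma_multiplier a f)" for I x
      using less.prems(2) by (simp_all add: v order_smult)
    have IH: "zcount {0<..} h \<le> zcount {0<..} u" "zcount {..<0} h \<le> zcount {..<0} u"
      "order 0 u = order 0 h" "zcount UNIV u = zcount UNIV h \<Longrightarrow> x \<noteq> 0 \<Longrightarrow> order x u \<le> 1" for x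
      using less.hyps[of h "a + 1"] h less.prems(2) by (auto simp: u_def)
    have zf: "zcount I f = (if \<theta> \<in> I then 1 else 0) + zcount I h" for I
      using zcount_mult[OF less.prems(1)[unfolded f], of I] by (simp only: f zcount_linear)
    have of: "order 0 f = (if \<theta> = 0 then 1 else 0) + order 0 h"
      using zf[of "{0}"] h less.prems(1) by (auto simp: zcount_singleton)
    note split = zcount_UNIV_real[OF u0] zcount_UNIV_real[OF v0] zcount_UNIV_real[OF h(1)]
    show ?thesis
    proof (cases "\<theta> = 0")
      case True
      have vu: "v = [:-0, 1:] * u" by (simp add: v_def rolle_step_def True)
      have zvu: "zcount I v = (if 0 \<in> I then 1 else 0) + zcount I u" for I
        using zcount_mult[OF v0[unfolded vu], of I] by (simp only: vu zcount_linear)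
      have ovu: "order x v = (if x = 0 then 1 else 0) + order x u" for x
        using zvu[of "{x}"] v0 u0 by (auto simp: zcount_singleton)
      show ?thesis
        using IH zvu[of UNIV] zvu[of "{0<..}"] zvu[of "{..<0}"] ovu zf[of UNIV] zf[of "{0<..}"]
          zf[of "{..<0}"] of
        by (auto simp: zv ov True)
    next
      case False
      have b: "1 + a > 0" using less.prems by simp
      note P = zcount_pos_rolle_step[OF u0 b False, folded v_def]
      note N = zcount_neg_rolle_step[OF u0 b False, folded v_def]
      have O: "order 0 v = order 0 u" unfolding v_def by (rule order_0_rolle_step[OF u0 b False])
      have simple: "order x v \<le> 1" if eq: "zcount UNIV v = zcount UNIV f" and x: "x \<noteq> 0" for x
      proof (rule ccontr)
        assume "\<not> ?thesis"
        then have o2: "order x v \<ge> 2" by simp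
        \<comment> \<open>Each inequality in the chain from $h$ over $u$ to $v$ is an equality, since the totals agree.\<close>
        have tot: "zcount UNIV u = zcount UNIV h"
          "zcount {0<..} u + (if \<theta> > 0 then 1 else 0) = zcount {0<..} v"
          "zcount {..<0} u + (if \<theta> < 0 then 1 else 0) = zcount {..<0} v"
          using eq zf[of UNIV] split IH(1-3) P(1) N(1) O False by (auto split: if_splits)
        have "order x u = Suc (order x v)"
          using P(2)[OF tot(2) _ o2] N(2)[OF tot(3) _ o2] x by (cases "x > 0") auto
        then show False using IH(4)[OF tot(1) x] o2 by simp
      qed
      show ?thesis
        using IH(1-3) P(1) N(1) O simple zf[of "{0<..}"] zf[of "{..<0}"] of False
        by (auto simp: zv ov split: if_splits)
    qed
  qed
qed

section \<open>The Appell sequence and the Laguerre combinations\<close>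

text \<open>
  The polynomials $Q(D)\,y^n/n! = \sum_j Q_j\, y^{n-j}/(n-j)!$ for the reversed polynomial
  $Q(t) = t^K P(1/t)$; their generating function is $e^{yz} Q(z)$.
\<close>
definition appell :: "real poly \<Rightarrow> nat \<Rightarrow> real poly" where
  "appell P n = (\<Sum>i\<le>n. monom (coeff (reflect_poly P) (n - i) / fact i) i)"

lemma coeff_appell:
  "coeff (appell P n) i = (if i \<le> n then coeff (reflect_poly P) (n - i) / fact i else 0)"
  by (auto simp: appell_def coeff_sum)

lemma pderiv_appell: "pderiv (appell P (Suc n)) = appell P n"
  by (rule poly_eqI) (simp add: coeff_pderiv coeff_appell field_simps del: of_nat_Suc)

lemma degree_appell:
  assumes "P \<noteq> 0"
  shows "degree (appell P n) = n" "appell P n \<noteq> 0" "lead_coeff (appell P n) = lead_coeff P / fact n"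
proof -
  have "coeff (appell P n) n = lead_coeff P / fact n"
    by (simp add: coeff_appell coeff_reflect_poly)
  moreover from this have "coeff (appell P n) n \<noteq> 0" using assms by simp
  moreover have "degree (appell P n) \<le> n"
    by (rule degree_le) (simp add: coeff_appell)
  ultimately show "degree (appell P n) = n" "appell P n \<noteq> 0"
    "lead_coeff (appell P n) = lead_coeff P / fact n"
    using le_degree[of "appell P n" n] by auto
qed

lemma reflect_poly_linear: "reflect_poly [:c, 1 :: real:] = [:1, c:]"
  by (cases "c = 0") (simp_all add: reflect_poly_def cCons_def)

text \<open>
  Multiplying $P$ by $x + c$ multiplies the reversed polynomial by $1 + c t$, and $t$ acts on the
  Appell sequence by lowering the index. This makes each pencil $q_{n+1} + c\,q_n$ an instance of the
  general situation, with $(x+c) P$ for $P$.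
\<close>
lemma appell_linear_factor:
  "appell ([:c, 1:] * P) (Suc n) = appell P (Suc n) + smult c (appell P n)"
proof (rule poly_eqI)
  fix i
  have R: "coeff (reflect_poly ([:c, 1:] * P)) k =
      coeff (reflect_poly P) k + (if k = 0 then 0 else c * coeff (reflect_poly P) (k - 1))" for k
    unfolding reflect_poly_mult reflect_poly_linear by (cases k) auto
  show "coeff (appell ([:c, 1:] * P) (Suc n)) i = coeff (appell P (Suc n) + smult c (appell P n)) i"
    unfolding coeff_add coeff_smult coeff_appell R by (auto simp: add_divide_distrib Suc_diff_le)
qed

lemma appell_eq_gamma_multiplier:
  assumes "n \<ge> degree P"
  shows "appell P n = smult (1 / fact (n - degree P))
           (monom 1 (n - degree P) * gamma_multiplier (real (n - degree P)) P)"
proof (rule poly_eqI)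
  fix i
  let ?m = "n - degree P"
  have f: "fact (?m + l) = (fact ?m * pochhammer (1 + real ?m) l :: real)" for l
  proof (induction l)
    case (Suc l)
    have "(fact (?m + Suc l) :: real) = (1 + real ?m + real l) * fact (?m + l)" by simp
    with Suc show ?case by (simp add: pochhammer_rec')
  qed simp
  show "coeff (appell P n) i =
      coeff (smult (1 / fact ?m) (monom 1 ?m * gamma_multiplier (real ?m) P)) i"
  proof (cases "i < ?m")
    case True
    then have "degree P < n - i" by linarith
    with True show ?thesis by (simp add: coeff_appell coeff_monom_mult coeff_reflect_poly)
  next
    case False
    then obtain l where l: "i = ?m + l" by (metis le_add_diff_inverse not_less)
    have "coeff (appell P n) i = coeff P l / fact i"
      using l assms by (cases "l \<le> degree P") (auto simp: coeff_appell coeff_reflect_poly coeff_eq_0)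
    then show ?thesis
      unfolding l coeff_smult coeff_monom_mult coeff_gamma_multiplier f by simp
  qed
qed

text \<open>
  Taylor expansion at $1$: by the Appell property the $i$-th derivative of the $n$-th polynomial is
  the one with index $n-i$.
\<close>
lemma coeff_appell_reflected:
  "i \<le> n \<Longrightarrow> coeff (pcompose (appell P n) [:1, -1:]) i = (-1) ^ i / fact i * poly (appell P (n - i)) 1"
proof (induction i arbitrary: n)
  case 0
  show ?case by (simp add: poly_0_coeff_0[symmetric] poly_pcompose)
next
  case (Suc i)
  then obtain m where m: "n = Suc m" by (cases n) auto
  have "pderiv (pcompose (appell P n) [:1, -1:]) = - pcompose (appell P m) [:1, -1:]"
    by (simp add: pderiv_pcompose m pderiv_appell pderiv_pCons)
  then have "coeff (pderiv (pcompose (appell P n) [:1, -1:])) i = - coeff (pcompose (appell P m) [:1, -1:]) i"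
    by simp
  then have "real (Suc i) * coeff (pcompose (appell P n) [:1, -1:]) (Suc i) =
      - ((-1) ^ i / fact i * poly (appell P (m - i)) 1)"
    using Suc m by (simp add: coeff_pderiv)
  then show ?case unfolding m by (simp add: field_simps del: of_nat_Suc)
qed

lemma poly_appell_1: "poly (appell P n) 1 = (\<Sum>j\<le>n. coeff (reflect_poly P) j / fact (n - j))"
proof -
  have "poly (appell P n) 1 = (\<Sum>i\<le>n. coeff (reflect_poly P) (n - i) / fact i)"
    by (simp add: appell_def poly_sum poly_monom)
  also have "\<dots> = (\<Sum>i\<le>n. coeff (reflect_poly P) i / fact (n - i))"
    by (rule sum.reindex_bij_witness[of _ "\<lambda>i. n - i" "\<lambda>i. n - i"]) auto
  finally show ?thesis .
qed

text \<open>
  The polynomials $q_n$ in terms of $P$ (see \<open>laguerre_comb_eq\<close>), for an arbitrary $P$, so that $(x+c) P$ is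
  covered as well, also for $c = 0$.
\<close>
definition laguerre_appell :: "real \<Rightarrow> real poly \<Rightarrow> nat \<Rightarrow> real poly" where
  "laguerre_appell a P n = gamma_multiplier a (pcompose (appell P n) [:1, -1:])"

lemma coeff_laguerre_appell:
  assumes "P \<noteq> 0"
  shows "coeff (laguerre_appell a P n) i =
    (if i \<le> n then (-1) ^ i / (fact i * pochhammer (1 + a) i) * poly (appell P (n - i)) 1 else 0)"
proof -
  have "degree (pcompose (appell P n) [:1, -1:]) = n"
    using degree_appell[OF assms] by (simp add: degree_pcompose)
  then show ?thesis
    by (auto simp: laguerre_appell_def coeff_gamma_multiplier coeff_appell_reflected coeff_eq_0)
qed

lemma degree_laguerre_appell:
  assumes "P \<noteq> 0" "a > -1"
  shows "degree (laguerre_appell a P n) = n" "laguerre_appell a P n \<noteq> 0"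
    "lead_coeff (laguerre_appell a P n) = lead_coeff P * (-1) ^ n / (fact n * pochhammer (1 + a) n)"
proof -
  have d: "degree (pcompose (appell P n) [:1, -1:]) = n"
    using degree_appell[OF assms(1)] by (simp add: degree_pcompose)
  then show deg: "degree (laguerre_appell a P n) = n"
    using assms by (simp add: laguerre_appell_def degree_gamma_multiplier)
  show "laguerre_appell a P n \<noteq> 0"
    using degree_appell(2)[OF assms(1)] pcompose_linear_nonzero[of "appell P n" "-1" 1] assms
    by (simp add: laguerre_appell_def gamma_multiplier_eq_0_iff)
  show "lead_coeff (laguerre_appell a P n) = lead_coeff P * (-1) ^ n / (fact n * pochhammer (1 + a) n)"
    unfolding deg using assms
    by (simp add: coeff_laguerre_appell poly_appell_1 coeff_reflect_poly)
qed

lemma gamma_multiplier_add: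
  "gamma_multiplier a (f + smult c g) = gamma_multiplier a f + smult c (gamma_multiplier a g)"
  by (rule poly_eqI) (simp add: coeff_gamma_multiplier add_divide_distrib)

lemma laguerre_appell_linear_factor:
  "laguerre_appell a ([:c, 1:] * P) (Suc n) =
   laguerre_appell a P (Suc n) + smult c (laguerre_appell a P n)"
  unfolding laguerre_appell_def appell_linear_factor pcompose_add pcompose_smult gamma_multiplier_add ..

lemma coeff_nlaguerre:
  assumes "\<alpha> > -1"
  shows "coeff (nlaguerre \<alpha> n) i =
    (if i \<le> n then (-1) ^ i / (fact i * fact (n - i) * pochhammer (1 + \<alpha>) i) else 0)"
proof -
  have pow: "[:0, -1 :: real:] ^ j = monom ((-1) ^ j) j" for j :: nat
    using monom_power[of "-1 :: real" 1 j] by (simp add: monom_altdef)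
  have "coeff (laguerre \<alpha> n) i =
      (\<Sum>j\<le>n. if j = i then ((real n + \<alpha>) gchoose (n - j)) / fact j * (-1) ^ j else 0)"
    unfolding laguerre_def coeff_sum by (intro sum.cong) (auto simp: pow)
  then have L: "coeff (laguerre \<alpha> n) i =
      (if i \<le> n then ((real n + \<alpha>) gchoose (n - i)) / fact i * (-1) ^ i else 0)"
    by simp
  show ?thesis
  proof (cases "i \<le> n")
    case True
    have "(real n + \<alpha>) gchoose (n - i) = pochhammer (1 + \<alpha> + real i) (n - i) / fact (n - i)"
      using True by (simp add: gbinomial_pochhammer' of_nat_diff algebra_simps)
    moreover have "pochhammer (1 + \<alpha>) n = pochhammer (1 + \<alpha>) i * pochhammer (1 + \<alpha> + real i) (n - i)"
      using True by (rule pochhammer_product)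
    moreover have "pochhammer (1 + \<alpha>) i > 0" "pochhammer (1 + \<alpha> + real i) (n - i) > 0"
      using assms by (auto intro!: pochhammer_pos)
    ultimately show ?thesis using True by (simp add: nlaguerre_def L field_simps)
  qed (simp add: nlaguerre_def L)
qed

lemma coeff_gamma_poly: "coeff (gamma_poly K \<gamma>) m = (if m \<le> K then \<gamma> (K - m) else 0)"
proof -
  have "coeff (gamma_poly K \<gamma>) m = (\<Sum>j\<le>K. if K - j = m then \<gamma> j else 0)"
    by (simp add: gamma_poly_def coeff_sum)
  also have "\<dots> = (\<Sum>j\<le>K. if K - (K - j) = m then \<gamma> (K - j) else 0)"
    by (rule sum.reindex_bij_witness[of _ "\<lambda>j. K - j" "\<lambda>j. K - j"]) auto
  also have "\<dots> = (\<Sum>j\<le>K. if j = m then \<gamma> (K - j) else 0)"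
    by (intro sum.cong) auto
  finally show ?thesis by simp
qed

lemma degree_gamma_poly:
  assumes "\<gamma> 0 = 1" shows "degree (gamma_poly K \<gamma>) = K"
proof (rule antisym)
  show "degree (gamma_poly K \<gamma>) \<le> K" by (rule degree_le) (simp add: coeff_gamma_poly)
  show "K \<le> degree (gamma_poly K \<gamma>)" by (rule le_degree) (simp add: coeff_gamma_poly assms)
qed

lemma laguerre_comb_eq:
  assumes "\<gamma> 0 = 1" "\<alpha> > -1"
  shows "laguerre_comb K \<gamma> \<alpha> n = laguerre_appell \<alpha> (gamma_poly K \<gamma>) n"
proof (rule poly_eqI)
  fix i
  let ?P = "gamma_poly K \<gamma>"
  let ?D = "fact i * pochhammer (1 + \<alpha>) i"
  have P: "?P \<noteq> 0" using coeff_gamma_poly[of K \<gamma> K] assms by auto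
  have R: "coeff (reflect_poly ?P) j = (if j \<le> K then \<gamma> j else 0)" for j
    using degree_gamma_poly[of \<gamma> K] assms by (auto simp: coeff_reflect_poly coeff_gamma_poly)
  have lhs: "coeff (laguerre_comb K \<gamma> \<alpha> n) i =
      (\<Sum>j\<le>min n K. if i \<le> n - j then \<gamma> j * ((-1) ^ i / (fact i * fact (n - j - i) * pochhammer (1 + \<alpha>) i)) else 0)"
    unfolding laguerre_comb_def coeff_sum coeff_smult coeff_nlaguerre[OF assms(2)]
    by (intro sum.cong) auto
  show "coeff (laguerre_comb K \<gamma> \<alpha> n) i = coeff (laguerre_appell \<alpha> ?P n) i"
  proof (cases "i \<le> n")
    case True
    have "coeff (laguerre_comb K \<gamma> \<alpha> n) i =
        (\<Sum>j\<in>{j\<in>{..min n K}. i \<le> n - j}. \<gamma> j * ((-1) ^ i / (fact i * fact (n - j - i) * pochhammer (1 + \<alpha>) i)))"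
      unfolding lhs by (rule sum.inter_filter[symmetric]) simp
    also have "\<dots> = (\<Sum>j\<le>n - i. (-1) ^ i / ?D * (coeff (reflect_poly ?P) j / fact (n - i - j)))"
      using True by (intro sum.mono_neutral_cong_left) (auto simp: R field_simps diff_commute)
    also have "\<dots> = coeff (laguerre_appell \<alpha> ?P n) i"
      using True by (simp add: coeff_laguerre_appell[OF P] poly_appell_1 sum_distrib_left)
    finally show ?thesis .
  next
    case False
    then show ?thesis
      unfolding lhs by (auto simp: coeff_laguerre_appell[OF P] intro!: sum.neutral)
  qed
qed

section \<open>Non-real zeros: the upper bound and the case of equality\<close>

lemma zcount_monom_mult:
  assumes "f \<noteq> (0 :: real poly)"
  shows "zcount I (monom 1 m * f) = (if 0 \<in> I then m else 0) + zcount I f"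
proof -
  have "zcount I (monom 1 m :: real poly) = (if 0 \<in> I then m else 0)"
    by (subst zcount_eq_sum[of _ "I \<inter> {0}"]) (auto simp: poly_monom)
  then show ?thesis using assms by (subst zcount_mult) auto
qed

lemma zcount_reflected:
  assumes "P \<noteq> 0"
  shows "zcount UNIV (pcompose (appell P n) [:1, -1:]) = zcount UNIV (appell P n)"
    and "zcount {..<0} (pcompose (appell P n) [:1, -1:]) = zcount {1<..} (appell P n)"
    and "order x (pcompose (appell P n) [:1, -1:]) = order (1 - x) (appell P n)"
proof -
  have "(\<lambda>x::real. 1 + -1 * x) ` UNIV = UNIV" "(\<lambda>x::real. 1 + -1 * x) ` {..<0} = {1<..}"
    by (auto simp: image_iff intro!: exI[of _ "1 - x" for x] bexI[of _ "1 - x" for x])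
  then show "zcount UNIV (pcompose (appell P n) [:1, -1:]) = zcount UNIV (appell P n)"
    "zcount {..<0} (pcompose (appell P n) [:1, -1:]) = zcount {1<..} (appell P n)"
    using degree_appell(2)[OF assms] by (subst zcount_pcompose_linear; simp)+
  show "order x (pcompose (appell P n) [:1, -1:]) = order (1 - x) (appell P n)"
    using degree_appell(2)[OF assms] by (subst order_pcompose_linear) auto
qed

lemma laguerre_appell_zeros:
  assumes "P \<noteq> 0" "a > -1"
  shows "zcount UNIV (appell P n) \<le> zcount UNIV (laguerre_appell a P n)"
    and "order 0 (laguerre_appell a P n) = order 1 (appell P n)"
    and "zcount UNIV (laguerre_appell a P n) = zcount UNIV (appell P n) \<Longrightarrow> x \<noteq> 0 \<Longrightarrow>
           order x (laguerre_appell a P n) \<le> 1"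
    and "zcount UNIV (laguerre_appell a P n) = zcount UNIV (appell P n) \<Longrightarrow>
           zcount {..<0} (laguerre_appell a P n) = zcount {1<..} (appell P n)"
proof -
  let ?s = "pcompose (appell P n) [:1, -1:]"
  have s: "?s \<noteq> 0" using degree_appell(2)[OF assms(1)] by (intro pcompose_linear_nonzero) auto
  have q: "laguerre_appell a P n \<noteq> 0" by (rule degree_laguerre_appell) fact+
  note G = gamma_multiplier_zeros[OF s assms(2), folded laguerre_appell_def]
  note R = zcount_reflected[OF assms(1)]
  note S = zcount_UNIV_real[OF s] zcount_UNIV_real[OF q]
  show "zcount UNIV (appell P n) \<le> zcount UNIV (laguerre_appell a P n)"
    using G S R(1)[of n] by linarith
  show "order 0 (laguerre_appell a P n) = order 1 (appell P n)"
    using G R(3)[of 0 n] by simp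
  assume eq: "zcount UNIV (laguerre_appell a P n) = zcount UNIV (appell P n)"
  show "order x (laguerre_appell a P n) \<le> 1" if "x \<noteq> 0"
    using G eq that R(1)[of n] by simp
  show "zcount {..<0} (laguerre_appell a P n) = zcount {1<..} (appell P n)"
    using G S eq R(1,2)[of n] by linarith
qed

lemma appell_zeros:
  assumes "P \<noteq> 0" "n \<ge> degree P"
  shows "zcount UNIV P + n \<le> zcount UNIV (appell P n) + degree P"
    and "zcount UNIV (appell P n) + degree P = zcount UNIV P + n \<Longrightarrow> x \<noteq> 0 \<Longrightarrow> order x (appell P n) \<le> 1"
    and "zcount UNIV (appell P n) + degree P = zcount UNIV P + n \<Longrightarrow>
           zcount {0<..} (appell P n) = zcount {0<..} P"
proof -
  define m where "m = n - degree P"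
  define G where "G = gamma_multiplier (real m) P"
  have m: "real m > -1" by simp
  have G0: "G \<noteq> 0" unfolding G_def using assms(1) gamma_multiplier_eq_0_iff[OF m] by simp
  have z: "zcount I (appell P n) = (if 0 \<in> I then m else 0) + zcount I G" for I
    unfolding appell_eq_gamma_multiplier[OF assms(2)]
    using G0 by (simp add: zcount_monom_mult flip: G_def m_def)
  note T = gamma_multiplier_zeros[OF assms(1) m, folded G_def]
  note S = zcount_UNIV_real[OF G0] zcount_UNIV_real[OF assms(1)]
  have U: "zcount UNIV P \<le> zcount UNIV G" using T S by linarith
  then show "zcount UNIV P + n \<le> zcount UNIV (appell P n) + degree P"
    using z[of UNIV] assms(2) by (simp add: m_def)
  assume "zcount UNIV (appell P n) + degree P = zcount UNIV P + n"
  then have eq: "zcount UNIV G = zcount UNIV P"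
    using z[of UNIV] assms(2) by (simp add: m_def)
  show "order x (appell P n) \<le> 1" if "x \<noteq> 0"
    using T eq that z[of "{x}"] degree_appell(2)[OF assms(1)] G0
    by (simp add: zcount_singleton)
  show "zcount {0<..} (appell P n) = zcount {0<..} P"
    using T S eq z[of "{0<..}"] by auto
qed

lemma zcount_pderiv:
  fixes f :: "real poly"
  assumes "degree f > 0" "zcount UNIV f > 0"
  shows "zcount UNIV f \<le> zcount UNIV (pderiv f) + 1"
    and "zcount UNIV f = zcount UNIV (pderiv f) + 1 \<Longrightarrow> order x (pderiv f) \<ge> 2 \<Longrightarrow>
           order x f = Suc (order x (pderiv f))"
proof -
  define Z where "Z = {x \<in> UNIV. poly f x = 0}"
  define S where "S = {x \<in> UNIV. poly (pderiv f) x = 0 \<and> poly f x \<noteq> 0}"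
  have f0: "f \<noteq> 0" and v0: "pderiv f \<noteq> 0" using assms(1) by (auto simp: pderiv_eq_0_iff)
  have finZ: "finite Z"
    unfolding Z_def by (rule finite_subset[OF _ poly_roots_finite[OF f0]]) blast
  have finS: "finite S"
    unfolding S_def by (rule finite_subset[OF _ poly_roots_finite[OF v0]]) blast
  have "Z \<noteq> {}"
  proof
    assume "Z = {}"
    then have "zcount UNIV f = 0" using f0 by (subst zcount_eq_sum[of _ "{}"]) (simp_all add: Z_def)
    then show False using assms(2) by simp
  qed
  have "card Z \<le> Suc (card {s \<in> S. s < Max Z})"
  proof (rule card_le_separated[OF finZ finS \<open>Z \<noteq> {}\<close>])
    fix x y assume xy: "x \<in> Z" "y \<in> Z" "x < y"
    obtain z where z: "x < z" "z < y" "poly f z \<noteq> 0"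
      using poly_nonzero_point f0 xy by blast
    show "\<exists>s\<in>S. x < s \<and> s < y"
    proof (rule rolle_off_zeros[of x y "poly f" z "poly (pderiv f)"])
      show "(poly f has_real_derivative poly (pderiv f) t) (at t)" for t by (rule poly_DERIV)
      show "continuous_on {x..y} (poly f)" by (intro continuous_intros)
    qed (use xy z in \<open>auto simp: Z_def S_def\<close>)
  qed
  also have "card {s \<in> S. s < Max Z} \<le> card S" using finS by (intro card_mono) auto
  finally have card: "card Z \<le> card S + 1" by simp
  have ord: "order x f = Suc (order x (pderiv f))" if "x \<in> UNIV" "poly f x = 0" for x
    using that f0 by (intro order_pderiv) auto
  have card': "card {x \<in> UNIV. poly f x = 0} + 0 \<le> card {x \<in> UNIV. poly (pderiv f) x = 0 \<and> poly f x \<noteq> 0} + 1"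
    using card unfolding Z_def S_def by (simp only: add_0_right)
  show "zcount UNIV f \<le> zcount UNIV (pderiv f) + 1"
    using zcount_rolle(1)[OF f0 v0 ord card'] by (simp only: add_0_right)
  show "order x f = Suc (order x (pderiv f))"
    if "zcount UNIV f = zcount UNIV (pderiv f) + 1" "order x (pderiv f) \<ge> 2"
    by (rule zcount_rolle(2)[OF f0 v0 ord card'])
       (use that in \<open>simp_all only: add_0_right UNIV_I\<close>)
qed

text \<open>
  Below the degree of $P$ the polynomials are derivatives of the one with index $\deg P$, and Rolle's theorem
  keeps all zeros real. A multiple zero at $1$ would be inherited by the polynomials with higher
  index, up to $\deg P$, where the zeros other than $0$ are known to be simple.
\<close>
lemma appell_real_rooted:
  assumes "P \<noteq> 0" "zcount UNIV P = degree P"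
  shows "zcount UNIV (appell P n) = n \<and> order 1 (appell P n) \<le> 1"
proof (cases "n \<ge> degree P")
  case True
  have "zcount UNIV (appell P n) = n"
    using appell_zeros(1)[OF assms(1) True] zcount_le_degree[of UNIV "appell P n"] assms
    by (simp add: degree_appell)
  then show ?thesis using appell_zeros(2)[OF assms(1) True, of 1] assms(2) by simp
next
  case False
  then have "n \<le> degree P" by simp
  then show ?thesis
  proof (induction rule: inc_induct)
    case base
    have "zcount UNIV (appell P (degree P)) = degree P"
      using appell_zeros(1)[OF assms(1), of "degree P"] zcount_le_degree[of UNIV "appell P (degree P)"] assms
      by (simp add: degree_appell)
    then show ?case using appell_zeros(2)[OF assms(1), of "degree P" 1] assms(2) by simp
  next
    case (step k)
    note D = zcount_pderiv[of "appell P (Suc k)", unfolded pderiv_appell]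
    have z: "zcount UNIV (appell P k) = k"
      using D(1) step degree_appell(1)[OF assms(1)] zcount_le_degree[of UNIV "appell P k"] by simp
    have "order 1 (appell P k) \<le> 1"
    proof (rule ccontr)
      assume "\<not> ?thesis"
      then have "order 1 (appell P (Suc k)) = Suc (order 1 (appell P k))" "order 1 (appell P k) \<ge> 2"
        using D(2)[of 1] z step degree_appell(1)[OF assms(1)] by simp_all
      then show False using step by simp
    qed
    with z show ?case by simp
  qed
qed

lemma laguerre_appell_nonreal_le:
  assumes "P \<noteq> 0" "a > -1" "n \<ge> degree P"
  shows "zcount UNIV P + n \<le> zcount UNIV (laguerre_appell a P n) + degree P"
  using laguerre_appell_zeros(1)[OF assms(1,2), of n] appell_zeros(1)[OF assms(1,3)] by linarith

lemma laguerre_appell_real_rooted: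
  assumes "P \<noteq> 0" "a > -1" "zcount UNIV P = degree P"
  shows "zcount UNIV (laguerre_appell a P n) = n" and "order x (laguerre_appell a P n) \<le> 1"
proof -
  note R = appell_real_rooted[OF assms(1,3), of n]
  show z: "zcount UNIV (laguerre_appell a P n) = n"
    using laguerre_appell_zeros(1)[OF assms(1,2), of n] R
      zcount_le_degree[of UNIV "laguerre_appell a P n"] degree_laguerre_appell(1)[OF assms(1,2)]
    by simp
  show "order x (laguerre_appell a P n) \<le> 1"
    using laguerre_appell_zeros(2,3)[OF assms(1,2), of n] R z by (cases "x = 0") auto
qed

text \<open>
  Both applications of the operator can only lose non-real zeros, so if the total number agrees at the
  ends then each of the two steps is exact.
\<close>
lemma laguerre_appell_exact:
  assumes "P \<noteq> 0" "a > -1" "n \<ge> degree P"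
    and "zcount UNIV (laguerre_appell a P n) + degree P = zcount UNIV P + n"
  shows "x \<noteq> 0 \<Longrightarrow> order x (laguerre_appell a P n) \<le> 1"
    and "zcount {..<0} (laguerre_appell a P n) = zcount {1<..} (appell P n)"
    and "zcount {0<..} (appell P n) = zcount {0<..} P"
proof -
  note A = appell_zeros[OF assms(1,3)] and L = laguerre_appell_zeros[OF assms(1,2), of n]
  have "zcount UNIV (laguerre_appell a P n) = zcount UNIV (appell P n)"
    "zcount UNIV (appell P n) + degree P = zcount UNIV P + n"
    using A(1) L(1) assms(4) by linarith+
  with A L show "x \<noteq> 0 \<Longrightarrow> order x (laguerre_appell a P n) \<le> 1"
    "zcount {..<0} (laguerre_appell a P n) = zcount {1<..} (appell P n)"
    "zcount {0<..} (appell P n) = zcount {0<..} P" by blast+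
qed

text \<open>
  Up to a power of $y$ and a constant the polynomial is $P(0)$ plus terms with denominators
  $(1+n-\deg P)_i$, $i \ge 1$, which tend to $0$ uniformly on $[0,1]$ as $n$ grows.
\<close>
lemma appell_no_zero_Ioc:
  assumes "poly P 0 \<noteq> 0"
  shows "\<exists>n0. \<forall>n\<ge>n0. \<forall>y\<in>{0<..1}. poly (appell P n) y \<noteq> 0"
proof -
  define M where "M = (\<Sum>i\<le>degree P. \<bar>coeff P i\<bar>)"
  obtain m0 :: nat where m0: "M / \<bar>poly P 0\<bar> < real m0" using reals_Archimedean2 by blast
  have "poly (appell P n) y \<noteq> 0" if n: "n \<ge> degree P + m0" and y: "0 < y" "y \<le> 1" for n y
  proof -
    define m where "m = n - degree P"
    let ?G = "gamma_multiplier (real m) P"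
    have m: "m \<ge> m0" "n \<ge> degree P" using n by (auto simp: m_def)
    have ge1: "pochhammer (2 + real m) i \<ge> 1" for i
    proof (induction i)
      case (Suc i)
      have "1 * 1 \<le> pochhammer (2 + real m) i * (2 + real m + real i)"
        using Suc by (intro mult_mono) auto
      then show ?case by (simp add: pochhammer_Suc)
    qed simp
    have poch: "pochhammer (1 + real m) (Suc i) \<ge> 1 + real m" for i
    proof -
      have "(1 + real m) * 1 \<le> (1 + real m) * pochhammer (2 + real m) i"
        using ge1 by (intro mult_left_mono) auto
      then show ?thesis by (simp add: pochhammer_rec)
    qed
    have t: "\<bar>coeff P (Suc i) / pochhammer (1 + real m) (Suc i) * y ^ Suc i\<bar> \<le> \<bar>coeff P (Suc i)\<bar> / (1 + real m)" for i
    proof -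
      have "\<bar>coeff P (Suc i)\<bar> / pochhammer (1 + real m) (Suc i) \<le> \<bar>coeff P (Suc i)\<bar> / (1 + real m)"
        using poch[of i] by (intro divide_left_mono) (auto intro!: mult_pos_pos pochhammer_pos)
      moreover have "\<bar>y ^ Suc i\<bar> \<le> 1" using y by (simp add: power_le_one abs_mult mult_le_one)
      moreover have "pochhammer (1 + real m) (Suc i) > 0" by (intro pochhammer_pos) auto
      ultimately have "\<bar>coeff P (Suc i)\<bar> / pochhammer (1 + real m) (Suc i) * \<bar>y ^ Suc i\<bar> \<le> \<bar>coeff P (Suc i)\<bar> / (1 + real m) * 1"
        by (intro mult_mono) auto
      then show ?thesis using \<open>pochhammer (1 + real m) (Suc i) > 0\<close> by (simp only: abs_mult abs_divide abs_of_pos mult_1_right)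
    qed
    have dG: "degree ?G = degree P" by (rule degree_gamma_multiplier) simp
    have "poly ?G y = (\<Sum>i\<le>degree P. coeff P i / pochhammer (1 + real m) i * y ^ i)"
      by (simp add: poly_altdef dG coeff_gamma_multiplier)
    also have "\<dots> = poly P 0 + (\<Sum>i<degree P. coeff P (Suc i) / pochhammer (1 + real m) (Suc i) * y ^ Suc i)"
      by (subst lessThan_Suc_atMost[symmetric], subst sum.lessThan_Suc_shift) (simp add: poly_0_coeff_0)
    finally have "\<bar>poly ?G y - poly P 0\<bar> = \<bar>\<Sum>i<degree P. coeff P (Suc i) / pochhammer (1 + real m) (Suc i) * y ^ Suc i\<bar>"
      by simp
    also have "\<dots> \<le> (\<Sum>i<degree P. \<bar>coeff P (Suc i)\<bar> / (1 + real m))"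
      using t by (intro order_trans[OF sum_abs] sum_mono) auto
    also have "\<dots> \<le> M / (1 + real m)"
    proof -
      have "M = \<bar>coeff P 0\<bar> + (\<Sum>i<degree P. \<bar>coeff P (Suc i)\<bar>)"
        unfolding M_def by (subst lessThan_Suc_atMost[symmetric], subst sum.lessThan_Suc_shift) simp
      then show ?thesis by (simp add: sum_divide_distrib[symmetric] divide_right_mono)
    qed
    also have "\<dots> < \<bar>poly P 0\<bar>"
    proof -
      have "M < \<bar>poly P 0\<bar> * real m0" using m0 assms by (simp add: field_simps)
      also have "\<dots> \<le> \<bar>poly P 0\<bar> * (1 + real m)" using m by (intro mult_left_mono) auto
      finally show ?thesis by (simp add: field_simps)
    qed
    finally have "poly ?G y \<noteq> 0" by auto
    then show ?thesis
      unfolding appell_eq_gamma_multiplier[OF m(2)] using y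
      by (simp add: poly_monom m_def)
  qed
  then show ?thesis by (intro exI[of _ "degree P + m0"]) auto
qed

section \<open>Interlacing from simple zeros in a pencil\<close>

lemma poly_pos_at_bot:
  fixes p :: "real poly"
  assumes "lead_coeff p * (-1) ^ degree p > 0"
  obtains B where "\<And>x. x \<le> B \<Longrightarrow> poly p x > 0"
proof -
  let ?r = "pcompose p [:0, -1:]"
  have "lead_coeff ?r = lead_coeff p * (-1) ^ degree p"
    by (subst lead_coeff_comp) auto
  then have "lead_coeff ?r > 0" using assms by simp
  then obtain N where N: "\<And>x. x \<ge> N \<Longrightarrow> poly ?r x > 0"
    using poly_pinfty_gt_lc[of ?r] by force
  have "poly p x > 0" if "x \<le> - N" for x
    using N[of "-x"] that by (simp add: poly_pcompose)
  then show ?thesis using that by blast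
qed

lemma poly_pos_at_top:
  fixes p :: "real poly"
  assumes "lead_coeff p > 0"
  obtains B where "\<And>x. x \<ge> B \<Longrightarrow> poly p x > 0"
  using poly_pinfty_gt_lc[OF assms] assms by (metis less_le_trans)

lemma poly_pos_left:
  fixes p :: "real poly"
  assumes "\<And>x. x \<le> B \<Longrightarrow> poly p x > 0" "\<And>x. x < v \<Longrightarrow> poly p x \<noteq> 0" "x < v"
  shows "poly p x > 0"
proof (rule ccontr)
  assume "\<not> ?thesis"
  then have neg: "poly p x < 0" using assms(2)[OF assms(3)] by simp
  have "min B (x - 1) < x" "poly p (min B (x - 1)) > 0" using assms(1) by auto
  then obtain y where "y < x" "poly p y = 0" using poly_IVT_neg[OF _ _ neg] by blast
  then show False using assms(2)[of y] assms(3) by auto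
qed

text \<open>
  Without a zero of $q$ on $[x,y]$ the quotient $p/q$ is monotone there, and it vanishes at both ends.
\<close>
lemma wronskian_zero_between:
  fixes p q :: "real poly"
  assumes "x < y" "poly p x = 0" "poly p y = 0"
    and "\<And>t. t \<in> {x..y} \<Longrightarrow> poly q t \<noteq> 0"
    and W: "\<And>t. poly (pderiv p) t * poly q t - poly p t * poly (pderiv q) t \<le> 0"
    and "x < z" "z < y"
  shows "poly p z = 0"
proof -
  let ?f = "\<lambda>t. poly p t / poly q t"
  have D: "\<exists>d. (?f has_real_derivative d) (at t) \<and> d \<le> 0" if "t \<in> {x..y}" for t
  proof (intro exI conjI)
    show "(?f has_real_derivative (poly (pderiv p) t * poly q t - poly p t * poly (pderiv q) t)
        / (poly q t * poly q t)) (at t)"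
      using assms(4)[OF that] by (intro DERIV_divide poly_DERIV) auto
    show "(poly (pderiv p) t * poly q t - poly p t * poly (pderiv q) t) / (poly q t * poly q t) \<le> 0"
      using W[of t] by (intro divide_nonpos_nonneg) auto
  qed
  have "?f z \<le> ?f x" using assms(1,6,7) D by (intro DERIV_nonpos_imp_nonincreasing[of x z ?f]) auto
  moreover have "?f y \<le> ?f z" using assms(1,6,7) D by (intro DERIV_nonpos_imp_nonincreasing[of z y ?f]) auto
  ultimately have "?f z = 0" using assms(2,3) by simp
  then show ?thesis using assms(4)[of z] assms(6,7) by auto
qed

lemma separates_wronskian:
  fixes p q :: "real poly"
  assumes "\<And>t. poly (pderiv p) t * poly q t - poly p t * poly (pderiv q) t \<le> 0"
    and "\<And>t. poly p t = 0 \<Longrightarrow> poly q t \<noteq> 0"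
  shows "separates (real_zeros q) (real_zeros p)"
  unfolding separates_def
proof (intro ballI impI notI)
  fix x y assume xy: "x \<in> real_zeros p" "y \<in> real_zeros p"
    "x < y \<and> real_zeros p \<inter> {x<..<y} = {}" and none: "real_zeros q \<inter> {x<..<y} = {}"
  have px: "poly p x = 0" "poly p y = 0" using xy by (auto simp: real_zeros_def)
  obtain z where z: "x < z" "z < y" using xy(3) dense by blast
  have "poly q t \<noteq> 0" if "t \<in> {x..y}" for t
  proof (cases "t = x \<or> t = y")
    case True
    then show ?thesis using px assms(2) by blast
  next
    case False
    then have "t \<in> {x<..<y}" using that by auto
    then show ?thesis using none by (auto simp: real_zeros_def)
  qed
  then have "poly p z = 0"
    using wronskian_zero_between[OF _ px _ assms(1) z] xy(3) by blast
  then show False using xy(3) z by (auto simp: real_zeros_def)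
qed

lemma order_le_1_imp_pderiv_nonzero:
  fixes p :: "real poly"
  assumes "p \<noteq> 0" "order x p \<le> 1" "poly p x = 0"
  shows "poly (pderiv p) x \<noteq> 0"
proof -
  have "order x p = Suc (order x (pderiv p))" using assms by (intro order_pderiv)
  then have "order x (pderiv p) = 0" using assms(2) by simp
  moreover have "pderiv p \<noteq> 0" using assms(1,3) by (metis degree_eq_zeroE pderiv_eq_0_iff poly_const_conv pCons_eq_0_iff)
  ultimately show ?thesis by (simp add: order_eq_0_iff)
qed

text \<open>
  A zero $x$ of the Wronskian is a double zero of a member of the pencil (with $c = -A(x)/B(x)$), or a double zero of
  $B$. Simplicity away from $0$ therefore determines the sign of the Wronskian up to a
  possible zero at $0$, which does not disturb monotonicity of $A/B$. The signs of the leading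
  coefficients say that $A$ and $B$ are positive near $-\infty$; this decides which of the two has the
  smallest zero.
\<close>
lemma interlaces_of_simple_pencil:
  fixes A B :: "real poly"
  assumes deg: "degree A = Suc n" "degree B = n"
    and lead: "lead_coeff A * (-1) ^ Suc n > 0" "lead_coeff B * (-1) ^ n > 0"
    and pencil: "\<And>x c. x \<noteq> 0 \<Longrightarrow> order x (A + smult c B) \<le> 1"
    and B: "\<And>x. order x B \<le> 1"
    and zero: "\<not> (poly A 0 = 0 \<and> poly B 0 = 0)"
  shows "interlaces (real_zeros A) (real_zeros B)"
proof -
  define W where "W = pderiv A * B - A * pderiv B"
  have A0: "A \<noteq> 0" and B0: "B \<noteq> 0" using deg lead by auto
  have F0: "A + smult c B \<noteq> 0" for c
  proof -
    have "coeff (A + smult c B) (Suc n) \<noteq> 0" using deg A0 by (simp add: coeff_eq_0) (metis leading_coeff_0_iff)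
    then show ?thesis by (metis coeff_0)
  qed
  have dB: "poly (pderiv B) x \<noteq> 0" if "poly B x = 0" for x
    using order_le_1_imp_pderiv_nonzero[OF B0 B that] .
  have dF: "poly (pderiv A) x + c * poly (pderiv B) x \<noteq> 0"
    if "x \<noteq> 0" "poly A x + c * poly B x = 0" for x c
    using order_le_1_imp_pderiv_nonzero[OF F0 pencil[OF that(1)], of c] that
    by (simp add: pderiv_add pderiv_smult)
  have disj: "poly B x \<noteq> 0" if "poly A x = 0" for x
  proof
    assume Bx: "poly B x = 0"
    then have "x \<noteq> 0" using zero that by auto
    from dF[OF this, of "- poly (pderiv A) x / poly (pderiv B) x"] that Bx dB[OF Bx]
    show False by simp
  qed
  have W_nz: "poly W x \<noteq> 0" if x: "x \<noteq> 0" for x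
  proof (cases "poly B x = 0")
    case True
    then show ?thesis using dB disj by (auto simp: W_def)
  next
    case False
    have "poly (pderiv A) x + (- poly A x / poly B x) * poly (pderiv B) x \<noteq> 0"
      by (rule dF[OF x]) (use False in simp)
    then show ?thesis using False by (simp add: W_def field_simps)
  qed
  \<comment> \<open>The two products contribute $n+1$ times and $n$ times the product of the leading coefficients.\<close>
  have cW: "coeff W (2 * n) = lead_coeff A * lead_coeff B"
  proof -
    have dA: "degree (pderiv A) = n" using deg by (simp add: degree_pderiv)
    have "coeff (pderiv A * B) (2 * n) = (1 + real n) * (lead_coeff A * lead_coeff B)"
      using coeff_mult_degree_sum[of "pderiv A" B] deg dA by (simp add: coeff_pderiv mult_2)
    moreover have "coeff (A * pderiv B) (2 * n) = real n * (lead_coeff A * lead_coeff B)"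
    proof (cases n)
      case 0
      then have "pderiv B = 0" using deg by (simp add: pderiv_eq_0_iff)
      with 0 show ?thesis by simp
    next
      case (Suc m)
      have "degree (pderiv B) = m" using deg Suc by (simp add: degree_pderiv)
      then show ?thesis
        using coeff_mult_degree_sum[of A "pderiv B"] deg Suc by (simp add: coeff_pderiv mult_2)
    qed
    ultimately show ?thesis by (simp add: W_def algebra_simps)
  qed
  have AB: "lead_coeff A * lead_coeff B < 0"
  proof -
    have "lead_coeff A < 0 \<and> lead_coeff B > 0 \<or> lead_coeff A > 0 \<and> lead_coeff B < 0"
      using lead by (cases "even n") simp_all
    then show ?thesis by (auto simp: mult_less_0_iff)
  qed
  have degW: "degree W = 2 * n"
  proof (rule antisym)
    have "degree (pderiv A * B) \<le> 2 * n"
      using degree_mult_le[of "pderiv A" B] deg by (simp add: degree_pderiv)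
    moreover have "degree (A * pderiv B) \<le> 2 * n"
    proof (cases n)
      case 0
      then have "pderiv B = 0" using deg by (simp add: pderiv_eq_0_iff)
      then show ?thesis by simp
    next
      case (Suc m)
      then show ?thesis using degree_mult_le[of A "pderiv B"] deg by (simp add: degree_pderiv)
    qed
    ultimately show "degree W \<le> 2 * n" unfolding W_def by (rule degree_diff_le)
    show "2 * n \<le> degree W" using cW AB by (intro le_degree) auto
  qed
  have leadW: "lead_coeff (- W) > 0" "lead_coeff (- W) * (-1) ^ degree (- W) > 0"
    using degW cW AB by simp_all
  have W_neg: "poly W x < 0" if x: "x \<noteq> 0" for x
  proof (rule ccontr)
    assume "\<not> ?thesis"
    then have pos: "poly (- W) x < 0" using W_nz[OF x] by simp
    show False
    proof (cases "x > 0")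
      case True
      obtain N where N: "\<And>x. x \<ge> N \<Longrightarrow> poly (- W) x > 0" using poly_pos_at_top[OF leadW(1)] by blast
      have "x < max N (x + 1)" "poly (- W) (max N (x + 1)) > 0" using N by auto
      then obtain y where "x < y" "poly (- W) y = 0" using poly_IVT_pos[OF _ pos] by blast
      then show False using W_nz[of y] True by auto
    next
      case False
      obtain N where N: "\<And>x. x \<le> N \<Longrightarrow> poly (- W) x > 0" using poly_pos_at_bot[OF leadW(2)] by blast
      have "min N (x - 1) < x" "poly (- W) (min N (x - 1)) > 0" using N by auto
      then obtain y where "y < x" "poly (- W) y = 0" using poly_IVT_neg[OF _ _ pos] by blast
      then show False using W_nz[of y] False by auto
    qed
  qed
  have W_le: "poly W x \<le> 0" for x
  proof (cases "x = 0")
    case True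
    show ?thesis
    proof (rule ccontr)
      assume "\<not> ?thesis"
      then have "poly W 0 > 0" using True by simp
      moreover have "poly W 1 < 0" by (rule W_neg) simp
      ultimately obtain y where "0 < y" "poly W y = 0" using poly_IVT_neg[of 0 1 W] by auto
      then show False using W_nz[of y] by simp
    qed
  next
    case False
    then show ?thesis using W_neg by (simp add: less_imp_le)
  qed
  have sep1: "separates (real_zeros B) (real_zeros A)"
    using W_le disj by (intro separates_wronskian) (auto simp: W_def)
  have "separates (real_zeros A) (real_zeros (- B))"
    using W_le disj by (intro separates_wronskian) (auto simp: W_def pderiv_minus algebra_simps)
  then have sep2: "separates (real_zeros A) (real_zeros B)" by (simp add: real_zeros_def)
  have fin: "finite (real_zeros A)" "finite (real_zeros B)"
    unfolding real_zeros_def using A0 B0 by (auto intro: poly_roots_finite)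
  obtain NA where NA: "\<And>x. x \<le> NA \<Longrightarrow> poly A x > 0"
    using poly_pos_at_bot[of A] lead deg by auto
  obtain NB where NB: "\<And>x. x \<le> NB \<Longrightarrow> poly B x > 0"
    using poly_pos_at_bot[of B] lead deg by auto
  have below: "\<exists>u<v. poly A u = 0" if v: "poly B v = 0" "\<And>t. t < v \<Longrightarrow> poly B t \<noteq> 0" for v
  proof (rule ccontr)
    assume none: "\<not> ?thesis"
    have Apos: "poly A x > 0" if "x < v" for x
      by (rule poly_pos_left[OF NA _ that]) (use none in auto)
    have Bpos: "poly B x > 0" if "x < v" for x
      by (rule poly_pos_left[OF NB _ that]) (use v in auto)
    have Av: "poly A v > 0"
    proof (rule ccontr)
      assume "\<not> ?thesis"
      then have "poly A v < 0" using disj[of v] v(1) by (cases "poly A v = 0") auto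
      moreover have "poly A (v - 1) > 0" by (rule Apos) simp
      ultimately obtain y where "y < v" "poly A y = 0" using poly_IVT_neg[of "v - 1" v A] by auto
      then show False using none by blast
    qed
    have "poly (pderiv B) v \<le> 0"
    proof (rule ccontr)
      assume "\<not> ?thesis"
      then obtain d where d: "d > 0" "\<And>h. 0 < h \<Longrightarrow> h < d \<Longrightarrow> poly B (v - h) < poly B v"
        using DERIV_pos_inc_left[OF poly_DERIV, of B v] by force
      have "poly B (v - d / 2) < 0" using d(2)[of "d / 2"] d(1) v(1) by simp
      moreover have "poly B (v - d / 2) > 0" using d(1) by (intro Bpos) simp
      ultimately show False by simp
    qed
    then have "poly (pderiv B) v < 0" using dB[OF v(1)] by simp
    then have "poly A v * poly (pderiv B) v < 0" using Av by (rule mult_pos_neg[rotated])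
    then have "poly W v > 0" using v(1) by (simp add: W_def)
    then show False using W_le[of v] by simp
  qed
  have min: "real_zeros A \<noteq> {} \<and> (real_zeros B \<noteq> {} \<longrightarrow> Min (real_zeros A) < Min (real_zeros B))"
  proof (cases "real_zeros B = {}")
    case False
    then have M: "Min (real_zeros B) \<in> real_zeros B" using fin by (intro Min_in) auto
    have "\<exists>u<Min (real_zeros B). poly A u = 0"
    proof (rule below)
      show "poly B (Min (real_zeros B)) = 0" using M by (simp add: real_zeros_def)
      show "poly B t \<noteq> 0" if "t < Min (real_zeros B)" for t
      proof
        assume "poly B t = 0"
        then have "Min (real_zeros B) \<le> t" using fin by (intro Min_le) (auto simp: real_zeros_def)
        then show False using that by simp
      qed
    qed
    then obtain u where u: "u < Min (real_zeros B)" "u \<in> real_zeros A" by (auto simp: real_zeros_def)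
    then have "Min (real_zeros A) < Min (real_zeros B)" using fin by (intro le_less_trans[OF Min_le u(1)]) auto
    then show ?thesis using u by auto
  next
    case True
    then have Bnz: "poly B x \<noteq> 0" for x by (auto simp: real_zeros_def)
    have Bpos: "poly B x > 0" for x
      by (rule poly_pos_left[OF NB, of _ "x + 1"]) (use Bnz in auto)
    have "lead_coeff B > 0"
    proof (rule ccontr)
      assume "\<not> ?thesis"
      then have "lead_coeff (- B) > 0" using B0 by (simp add: less_le)
      from poly_pos_at_top[OF this] obtain N where "\<And>x. x \<ge> N \<Longrightarrow> poly (- B) x > 0" by blast
      from this[of N] Bpos[of N] show False by simp
    qed
    then have "lead_coeff (- A) > 0" using AB by (simp add: mult_less_0_iff)
    from poly_pos_at_top[OF this] obtain N where N: "\<And>x. x \<ge> N \<Longrightarrow> poly (- A) x > 0" by blast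
    have "min NA (N - 1) < N" "poly A (min NA (N - 1)) > 0" "poly A N < 0"
      using NA N[of N] by auto
    then obtain y where "poly A y = 0" using poly_IVT_neg by blast
    then show ?thesis using True by (auto simp: real_zeros_def)
  qed
  have "real_zeros A \<inter> real_zeros B = {}" using disj by (auto simp: real_zeros_def)
  then show ?thesis
    unfolding interlaces_def strictly_interlaces_def using fin min sep1 sep2 by simp
qed

section \<open>Non-real zeros: the lower bound\<close>

lemma zorder_poly_times:
  assumes "p \<noteq> 0" "open s" "z \<in> s" "e holomorphic_on s" "e z \<noteq> 0"
  shows "zorder (\<lambda>w. poly p w * e w) z = int (order z p)"
proof -
  obtain q where q: "p = [:-z, 1:] ^ order z p * q" "\<not> [:-z, 1:] dvd q"
    using order_decomp[OF assms(1)] by blast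
  show ?thesis
  proof (rule zorder_eqI[OF assms(2,3)])
    show "(\<lambda>w. poly q w * e w) holomorphic_on s" using assms(4) by (intro holomorphic_intros)
    show "poly q z * e z \<noteq> 0" using q(2) assms(5) by (simp add: poly_eq_0_iff_dvd)
    show "poly p w * e w = poly q w * e w * (w - z) powi int (order z p)" for w
      by (subst q(1)) (simp add: poly_power)
  qed
qed

text \<open>
  Rouche's theorem for polynomials that are multiplied by zero-free holomorphic functions, which take up
  the factors $e^{1/w}$ and $w^{-N}$ of the comparison below.
\<close>
lemma zcount_rouche:
  fixes p q :: "complex poly"
  assumes "p \<noteq> 0" "q \<noteq> 0" "open s" "connected s" "0 < r" "cball z0 r \<subseteq> s"
    and e: "e1 holomorphic_on s" "e2 holomorphic_on s"
      "\<And>w. w \<in> s \<Longrightarrow> e1 w \<noteq> 0" "\<And>w. w \<in> s \<Longrightarrow> e2 w \<noteq> 0"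
    and less: "\<And>w. w \<in> sphere z0 r \<Longrightarrow>
      norm (poly q w * e2 w - poly p w * e1 w) < norm (poly p w * e1 w)"
  shows "zcount (ball z0 r) q = zcount (ball z0 r) p"
proof -
  let ?f = "\<lambda>w. poly p w * e1 w" and ?h = "\<lambda>w. poly q w * e2 w"
  let ?\<gamma> = "circlepath z0 r"
  have sum: "(\<Sum>w\<in>{w \<in> s. poly x w * e w = 0}. winding_number ?\<gamma> w * of_int (zorder (\<lambda>w. poly x w * e w) w)) =
      of_nat (zcount (ball z0 r) x)"
    if x: "x \<noteq> 0" "e holomorphic_on s" "\<And>w. w \<in> s \<Longrightarrow> e w \<noteq> 0" "\<And>w. w \<in> sphere z0 r \<Longrightarrow> poly x w \<noteq> 0" for x e
  proof -
    have "(\<Sum>w\<in>{w \<in> s. poly x w * e w = 0}. winding_number ?\<gamma> w * of_int (zorder (\<lambda>w. poly x w * e w) w)) =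
        (\<Sum>w\<in>{w \<in> s. poly x w = 0}. if w \<in> ball z0 r then of_nat (order w x) else 0)"
    proof (rule sum.cong)
      show "{w \<in> s. poly x w * e w = 0} = {w \<in> s. poly x w = 0}" using x(3) by auto
      fix w assume w: "w \<in> {w \<in> s. poly x w = 0}"
      have "zorder (\<lambda>w. poly x w * e w) w = int (order w x)"
        using w x assms(3) by (intro zorder_poly_times[of _ s]) auto
      moreover have "winding_number ?\<gamma> w = (if w \<in> ball z0 r then 1 else 0)"
      proof (cases "w \<in> ball z0 r")
        case True
        then show ?thesis by (simp add: winding_number_circlepath dist_norm norm_minus_commute)
      next
        case False
        moreover have "w \<notin> sphere z0 r" using w x(4) by auto
        ultimately have "w \<notin> cball z0 r" by auto
        then have "winding_number ?\<gamma> w = 0"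
          using assms(5) by (intro winding_number_zero_outside[of _ "cball z0 r"]) auto
        then show ?thesis using False by simp
      qed
      ultimately show "winding_number ?\<gamma> w * of_int (zorder (\<lambda>w. poly x w * e w) w) =
          (if w \<in> ball z0 r then of_nat (order w x) else 0)" by simp
    qed
    also have "\<dots> = (\<Sum>w\<in>{w \<in> ball z0 r. poly x w = 0}. of_nat (order w x))"
    proof (rule sum.mono_neutral_cong_right)
      show "finite {w \<in> s. poly x w = 0}"
        by (rule finite_subset[OF _ poly_roots_finite[OF x(1)]]) auto
    qed (use assms(6) ball_subset_cball in auto)
    also have "\<dots> = of_nat (zcount (ball z0 r) x)"
    proof -
      have "finite {w \<in> ball z0 r. poly x w = 0}"
        by (rule finite_subset[OF _ poly_roots_finite[OF x(1)]]) auto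
      then show ?thesis
        using x(1) by (subst zcount_eq_sum[of _ "{w \<in> ball z0 r. poly x w = 0}"]) auto
    qed
    finally show ?thesis .
  qed
  have fin: "finite {w \<in> s. poly x w * e w = 0}" if "x \<noteq> 0" "\<And>w. w \<in> s \<Longrightarrow> e w \<noteq> 0" for x :: "complex poly" and e
    by (rule finite_subset[OF _ poly_roots_finite[OF that(1)]]) (use that in auto)
  have "(\<Sum>w\<in>{w \<in> s. ?f w + (?h w - ?f w) = 0}.
          winding_number ?\<gamma> w * of_int (zorder (\<lambda>w. ?f w + (?h w - ?f w)) w)) =
        (\<Sum>w\<in>{w \<in> s. ?f w = 0}. winding_number ?\<gamma> w * of_int (zorder ?f w))"
  proof (rule Rouche_theorem)
    show "finite {w \<in> s. ?f w + (?h w - ?f w) = 0}" using fin[OF assms(2) e(4)] by simp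
    show "finite {w \<in> s. ?f w = 0}" using fin[OF assms(1) e(3)] by simp
    show "?f holomorphic_on s" "(\<lambda>w. ?h w - ?f w) holomorphic_on s"
      using e by (auto intro!: holomorphic_intros)
    show "path_image ?\<gamma> \<subseteq> s" using assms(5,6) by auto
    show "\<forall>w\<in>path_image ?\<gamma>. cmod (?h w - ?f w) < cmod (?f w)" using less assms(5) by auto
    show "\<forall>w. w \<notin> s \<longrightarrow> winding_number ?\<gamma> w = 0"
      using assms(5,6) by (auto intro!: winding_number_zero_outside[of _ "cball z0 r"])
  qed (use assms in auto)
  moreover have "(\<Sum>w\<in>{w \<in> s. ?f w = 0}. winding_number ?\<gamma> w * of_int (zorder ?f w)) = of_nat (zcount (ball z0 r) p)"
  proof (rule sum[OF assms(1) e(1,3)])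
    show "poly p w \<noteq> 0" if "w \<in> sphere z0 r" for w using less[OF that] by auto
  qed
  moreover have "(\<Sum>w\<in>{w \<in> s. ?h w = 0}. winding_number ?\<gamma> w * of_int (zorder ?h w)) = of_nat (zcount (ball z0 r) q)"
  proof (rule sum[OF assms(2) e(2,4)])
    show "poly q w \<noteq> 0" if "w \<in> sphere z0 r" for w using less[OF that] by auto
  qed
  ultimately have "(of_nat (zcount (ball z0 r) q) :: complex) = of_nat (zcount (ball z0 r) p)" by simp
  then show ?thesis by (simp only: of_nat_eq_iff)
qed

text \<open>
  The quotient $N!\,(1+a)_N / ((N-k)!\,(1+a)_{N-k}\,N^{2k})$ for $k \le N$. The product form vanishes for
  $k > N > 0$ and shows the limit $1$ for $N \to \infty$ termwise.
\<close>
definition scaled_ratio :: "real \<Rightarrow> nat \<Rightarrow> nat \<Rightarrow> real" where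
  "scaled_ratio a N k = (\<Prod>i<k. (1 - real i / real N) * (1 + (a - real i) / real N))"

lemma scaled_ratio_eq:
  assumes "k \<le> N" "N > 0" "a > -1"
  shows "scaled_ratio a N k * (fact (N - k) * pochhammer (1 + a) (N - k)) * real N ^ (2 * k) =
         fact N * pochhammer (1 + a) N"
  using assms(1)
proof (induction k)
  case 0
  then show ?case by (simp add: scaled_ratio_def)
next
  case (Suc k)
  define m where "m = N - Suc k"
  have m: "N - k = Suc m" "real N = real m + 1 + real k" using Suc.prems by (auto simp: m_def)
  have fac: "(1 - real k / real N) * (1 + (a - real k) / real N) * (real N)\<^sup>2 = (1 + real m) * (1 + a + real m)"
  proof -
    have "1 - real k / real N = (1 + real m) / real N" "1 + (a - real k) / real N = (1 + a + real m) / real N"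
      using assms(2) m(2) by (simp_all add: diff_divide_distrib[symmetric] add_divide_distrib[symmetric] divide_simps)
    then show ?thesis using assms(2) by (simp add: power2_eq_square)
  qed
  have "scaled_ratio a N (Suc k) * (fact m * pochhammer (1 + a) m) * real N ^ (2 * Suc k) =
      scaled_ratio a N k * (fact m * pochhammer (1 + a) m) * real N ^ (2 * k) *
      ((1 - real k / real N) * (1 + (a - real k) / real N) * (real N)\<^sup>2)"
    by (simp add: scaled_ratio_def power2_eq_square mult_ac)
  also have "\<dots> = scaled_ratio a N k * (fact (Suc m) * pochhammer (1 + a) (Suc m)) * real N ^ (2 * k)"
    unfolding fac by (simp add: pochhammer_Suc mult_ac)
  also have "\<dots> = fact N * pochhammer (1 + a) N" using Suc m(1) by simp
  finally show ?case by (simp add: m_def)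
qed

lemma scaled_ratio_eq_0: "k > N \<Longrightarrow> N > 0 \<Longrightarrow> scaled_ratio a N k = 0"
  unfolding scaled_ratio_def by (rule prod_zero) (auto intro!: bexI[of _ N])

lemma scaled_ratio_bound:
  assumes "N > 0" "a > -1"
  shows "\<bar>scaled_ratio a N k\<bar> \<le> (1 + \<bar>a\<bar>) ^ k"
proof (cases "k \<le> N")
  case True
  have "\<bar>scaled_ratio a N k\<bar> = (\<Prod>i<k. \<bar>(1 - real i / real N) * (1 + (a - real i) / real N)\<bar>)"
    unfolding scaled_ratio_def by (rule abs_prod)
  also have "\<dots> \<le> (\<Prod>i<k. 1 + \<bar>a\<bar>)"
  proof (intro prod_mono conjI)
    fix i assume "i \<in> {..<k}"
    then have i: "real i + 1 \<le> real N" using True by auto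
    have 1: "0 \<le> 1 - real i / real N" "1 - real i / real N \<le> 1" using i assms by (auto simp: field_simps)
    have "a / real N \<le> \<bar>a\<bar> / 1" using i assms by (intro frac_le) auto
    moreover have "(a - real i) / real N = a / real N - real i / real N" by (simp add: diff_divide_distrib)
    ultimately have 2: "0 \<le> 1 + (a - real i) / real N" "1 + (a - real i) / real N \<le> 1 + \<bar>a\<bar>"
      using i assms 1 by (auto simp: field_simps)
    have "(1 - real i / real N) * (1 + (a - real i) / real N) \<le> 1 * (1 + \<bar>a\<bar>)"
      using 1 2 by (intro mult_mono) auto
    then show "\<bar>(1 - real i / real N) * (1 + (a - real i) / real N)\<bar> \<le> 1 + \<bar>a\<bar>"
      using 1 2 by (simp add: abs_mult)
  qed auto
  finally show ?thesis by simp
next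
  case False
  then show ?thesis using assms by (simp add: scaled_ratio_eq_0)
qed

lemma scaled_ratio_tendsto: "(\<lambda>N. scaled_ratio a N k) \<longlonglongrightarrow> 1"
proof -
  have "(\<lambda>N. \<Prod>i<k. (1 - real i / real N) * (1 + (a - real i) / real N)) \<longlonglongrightarrow> (\<Prod>i<k. (1 - 0) * (1 + 0))"
    by (intro tendsto_intros lim_const_over_n)
  then show ?thesis by (simp add: scaled_ratio_def)
qed

text \<open>
  Tannery's theorem applied to the sum of the moduli of the differences at $|u| = T$, which does not depend on $u$; the majorant
  comes from \<open>scaled_ratio_bound\<close>.
\<close>
lemma scaled_ratio_uniform:
  fixes b :: "nat \<Rightarrow> real"
  assumes "a > -1" "\<And>t. t > 0 \<Longrightarrow> summable (\<lambda>k. \<bar>b k\<bar> * t ^ k)" "T > 0" "\<epsilon> > 0"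
  shows "\<forall>\<^sub>F N in sequentially. \<forall>u::complex. norm u \<le> T \<longrightarrow>
    norm ((\<Sum>k\<le>N. of_real (b k * scaled_ratio a N k) * u ^ k) - (\<Sum>k. of_real (b k) * u ^ k)) < \<epsilon>"
proof -
  let ?g = "\<lambda>k N. \<bar>b k\<bar> * \<bar>scaled_ratio a N k - 1\<bar> * T ^ k"
  let ?M = "\<lambda>k. \<bar>b k\<bar> * ((1 + \<bar>a\<bar>) * T) ^ k + \<bar>b k\<bar> * T ^ k"
  have M: "summable ?M"
    using assms(2)[of "(1 + \<bar>a\<bar>) * T"] assms(2)[of T] assms(3) by (intro summable_add) auto
  have bound: "norm (?g k N) \<le> ?M k" if "N > 0" for k N
  proof -
    have "\<bar>scaled_ratio a N k - 1\<bar> \<le> (1 + \<bar>a\<bar>) ^ k + 1"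
      using scaled_ratio_bound[OF that assms(1), of k] by linarith
    then have "?g k N \<le> \<bar>b k\<bar> * ((1 + \<bar>a\<bar>) ^ k + 1) * T ^ k"
      using assms(3) by (intro mult_right_mono mult_left_mono) auto
    also have "\<dots> = ?M k" unfolding power_mult_distrib by (simp add: algebra_simps)
    finally show ?thesis using assms(3) by (simp add: abs_mult)
  qed
  have "(\<lambda>N. suminf (\<lambda>k. ?g k N)) \<longlonglongrightarrow> suminf (\<lambda>k. \<bar>b k\<bar> * \<bar>1 - 1\<bar> * T ^ k)"
  proof (rule tannerys_theorem[THEN conjunct2, THEN conjunct2])
    show "(\<lambda>N. ?g k N) \<longlonglongrightarrow> \<bar>b k\<bar> * \<bar>1 - 1\<bar> * T ^ k" for k
      by (intro tendsto_intros scaled_ratio_tendsto)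
    have "\<forall>\<^sub>F N in sequentially. \<forall>k. norm (?g k N) \<le> ?M k"
      using eventually_gt_at_top[of 0] by eventually_elim (use bound in blast)
    then show "\<forall>\<^sub>F (k, N) in at_top \<times>\<^sub>F sequentially. norm (?g k N) \<le> ?M k"
      unfolding eventually_prod_filter
      by (intro exI[of _ "\<lambda>_. True"] exI[of _ "\<lambda>N. \<forall>k. norm (?g k N) \<le> ?M k"]) auto
  qed (use M in auto)
  then have "(\<lambda>N. suminf (\<lambda>k. ?g k N)) \<longlonglongrightarrow> 0" by simp
  then have ev: "\<forall>\<^sub>F N in sequentially. suminf (\<lambda>k. ?g k N) < \<epsilon>"
    using assms(4) by (auto dest: order_tendstoD)
  show ?thesis
    using ev eventually_gt_at_top[of 0]
  proof eventually_elim
    case (elim N)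
    show ?case
    proof (intro allI impI)
      fix u :: complex assume u: "norm u \<le> T"
      have sum_g: "summable (\<lambda>k. ?g k N)"
        using bound[OF elim(2)] by (intro summable_comparison_test[OF _ M]) auto
      have le: "norm (of_real (b k * (scaled_ratio a N k - 1)) * u ^ k) \<le> ?g k N" for k
        unfolding norm_mult norm_power norm_of_real abs_mult
        using u by (intro mult_left_mono power_mono) auto
      have s1: "(\<lambda>k. of_real (b k * scaled_ratio a N k) * u ^ k) sums (\<Sum>k\<le>N. of_real (b k * scaled_ratio a N k) * u ^ k)"
        using elim(2) by (intro sums_finite) (auto simp: scaled_ratio_eq_0)
      have "summable (\<lambda>k. of_real (b k) * u ^ k)"
      proof (rule summable_comparison_test)
        show "\<exists>n0. \<forall>k\<ge>n0. norm (of_real (b k) * u ^ k) \<le> \<bar>b k\<bar> * T ^ k"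
          using u by (auto simp: norm_mult norm_power intro!: mult_left_mono power_mono)
      qed (rule assms(2)[OF assms(3)])
      then have "(\<lambda>k. of_real (b k * scaled_ratio a N k) * u ^ k - of_real (b k) * u ^ k) sums
          ((\<Sum>k\<le>N. of_real (b k * scaled_ratio a N k) * u ^ k) - (\<Sum>k. of_real (b k) * u ^ k))"
        by (intro sums_diff s1 summable_sums)
      then have eq: "(\<Sum>k\<le>N. of_real (b k * scaled_ratio a N k) * u ^ k) - (\<Sum>k. of_real (b k) * u ^ k) =
          (\<Sum>k. of_real (b k * (scaled_ratio a N k - 1)) * u ^ k)"
        by (simp add: sums_iff algebra_simps)
      have "norm (\<Sum>k. of_real (b k * (scaled_ratio a N k - 1)) * u ^ k) \<le> suminf (\<lambda>k. ?g k N)"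
        using le sum_g by (intro norm_suminf_le)
      then show "norm ((\<Sum>k\<le>N. of_real (b k * scaled_ratio a N k) * u ^ k) - (\<Sum>k. of_real (b k) * u ^ k)) < \<epsilon>"
        unfolding eq using elim(1) by simp
    qed
  qed
qed

text \<open>
  The generating function $\sum_k r_k(1) u^k = e^u Q(u)$ at $u = 1/w$, where $Q(1/w) = P(w)/w^K$.
\<close>
lemma appell_1_series:
  fixes P :: "real poly"
  shows "summable (\<lambda>k. \<bar>poly (appell P k) 1\<bar> * \<bar>t\<bar> ^ k)"
    and "w \<noteq> 0 \<Longrightarrow> (\<lambda>k. of_real (poly (appell P k) 1) * (1 / w) ^ k) sums
           (exp (1 / w) * poly (map_poly complex_of_real P) w / w ^ degree P)"
proof -
  let ?R = "\<lambda>j. coeff (reflect_poly P) j"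
  have R0: "?R j = 0" if "j \<notin> {..degree P}" for j using that by (simp add: coeff_reflect_poly)
  have sR: "summable (\<lambda>j. norm (of_real (?R j) * u ^ j))" for u :: "'a :: {real_normed_field, banach}"
    by (rule summable_finite[of "{..degree P}"]) (use R0 in auto)
  have sE: "summable (\<lambda>j. norm (u ^ j /\<^sub>R fact j))" for u :: "'a :: {real_normed_field, banach}"
    by (rule summable_norm_exp)
  have "summable (\<lambda>k. \<Sum>i\<le>k. (\<bar>?R i\<bar> * \<bar>t\<bar> ^ i) * (\<bar>t\<bar> ^ (k - i) /\<^sub>R fact (k - i)))"
    using sR[of "\<bar>t\<bar>"] sE[of "\<bar>t\<bar>"] by (intro summable_Cauchy_product) (simp_all add: abs_mult power_abs)
  moreover have "\<bar>poly (appell P k) 1\<bar> * \<bar>t\<bar> ^ k \<le>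
      (\<Sum>i\<le>k. (\<bar>?R i\<bar> * \<bar>t\<bar> ^ i) * (\<bar>t\<bar> ^ (k - i) /\<^sub>R fact (k - i)))" for k
  proof -
    have "\<bar>poly (appell P k) 1\<bar> * \<bar>t\<bar> ^ k \<le> (\<Sum>i\<le>k. \<bar>?R i / fact (k - i)\<bar>) * \<bar>t\<bar> ^ k"
      unfolding poly_appell_1 by (intro mult_right_mono sum_abs) auto
    also have "\<dots> = (\<Sum>i\<le>k. (\<bar>?R i\<bar> * \<bar>t\<bar> ^ i) * (\<bar>t\<bar> ^ (k - i) /\<^sub>R fact (k - i)))"
      unfolding sum_distrib_right
    proof (rule sum.cong)
      fix i assume "i \<in> {..k}"
      then have "\<bar>t\<bar> ^ k = \<bar>t\<bar> ^ i * \<bar>t\<bar> ^ (k - i)" by (simp flip: power_add)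
      then show "\<bar>?R i / fact (k - i)\<bar> * \<bar>t\<bar> ^ k = (\<bar>?R i\<bar> * \<bar>t\<bar> ^ i) * (\<bar>t\<bar> ^ (k - i) /\<^sub>R fact (k - i))"
        by (simp add: divide_inverse abs_mult mult_ac)
    qed simp
    finally show ?thesis .
  qed
  ultimately show "summable (\<lambda>k. \<bar>poly (appell P k) 1\<bar> * \<bar>t\<bar> ^ k)"
    by (intro summable_comparison_test[of "\<lambda>k. \<bar>poly (appell P k) 1\<bar> * \<bar>t\<bar> ^ k"]) (auto simp: abs_mult)
  assume w: "w \<noteq> (0 :: complex)"
  let ?u = "1 / w"
  have "(\<lambda>k. \<Sum>i\<le>k. (of_real (?R i) * ?u ^ i) * (?u ^ (k - i) /\<^sub>R fact (k - i))) sums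
      ((\<Sum>j. of_real (?R j) * ?u ^ j) * (\<Sum>j. ?u ^ j /\<^sub>R fact j))"
    by (rule Cauchy_product_sums[OF sR sE])
  moreover have "(\<Sum>i\<le>k. (of_real (?R i) * ?u ^ i) * (?u ^ (k - i) /\<^sub>R fact (k - i))) =
      of_real (poly (appell P k) 1) * ?u ^ k" for k
    unfolding poly_appell_1 of_real_sum sum_distrib_right
  proof (rule sum.cong)
    fix i assume "i \<in> {..k}"
    then have "?u ^ k = ?u ^ i * ?u ^ (k - i)" by (simp flip: power_add)
    then show "(of_real (?R i) * ?u ^ i) * (?u ^ (k - i) /\<^sub>R fact (k - i)) = of_real (?R i / fact (k - i)) * ?u ^ k"
      by (simp add: scaleR_conv_of_real divide_inverse mult_ac)
  qed simp
  moreover have "(\<Sum>j. of_real (?R j) * ?u ^ j) = poly (map_poly complex_of_real P) w / w ^ degree P"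
  proof -
    have "(\<Sum>j. of_real (?R j) * ?u ^ j) = (\<Sum>j\<le>degree P. of_real (?R j) * ?u ^ j)"
      by (rule suminf_finite) (use R0 in auto)
    also have "\<dots> = (\<Sum>j\<le>degree P. of_real (coeff P (degree P - j)) * ?u ^ j)"
      by (intro sum.cong) (auto simp: coeff_reflect_poly)
    also have "\<dots> = (\<Sum>i\<le>degree P. of_real (coeff P i) * ?u ^ (degree P - i))"
      by (rule sum.reindex_bij_witness[of _ "\<lambda>i. degree P - i" "\<lambda>i. degree P - i"]) auto
    also have "\<dots> = (\<Sum>i\<le>degree P. of_real (coeff P i) * w ^ i / w ^ degree P)"
      using w by (intro sum.cong) (auto simp: power_one_over power_diff field_simps)
    also have "\<dots> = poly (map_poly complex_of_real P) w / w ^ degree P"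
      by (simp add: poly_altdef degree_map_poly coeff_map_poly sum_divide_distrib)
    finally show ?thesis .
  qed
  ultimately show "(\<lambda>k. of_real (poly (appell P k) 1) * (1 / w) ^ k) sums
      (exp (1 / w) * poly (map_poly complex_of_real P) w / w ^ degree P)"
    by (simp add: exp_def mult.commute)
qed

text \<open>
  In the variable $w = -x/N^2$ and divided by its leading term, the polynomial of index $N$ is the $N$-th
  partial sum of $\sum_k r_k(1) w^{-k}$ with coefficients modified by the scaled ratios. The case $d = 1$
  is the second member of the pencil, normalised by the same factor.
\<close>
lemma poly_scaled_laguerre_appell:
  fixes w :: complex
  assumes "P \<noteq> 0" "a > -1" "N > 0" "d \<le> N" "w \<noteq> 0"
  shows "poly (map_poly of_real (pcompose (laguerre_appell a P (N - d)) [:0, - (real N)\<^sup>2:])) w *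
           (of_real (fact N * pochhammer (1 + a) N / real N ^ (2 * N)) / w ^ N) =
         (\<Sum>k\<le>N. of_real ((if k < d then 0 else poly (appell P (k - d)) 1) * scaled_ratio a N k) * (1 / w) ^ k)"
proof -
  let ?q = "laguerre_appell a P (N - d)" and ?C = "fact N * pochhammer (1 + a) N / real N ^ (2 * N)"
  let ?r = "map_poly complex_of_real (pcompose ?q [:0, - (real N)\<^sup>2:])"
  have deg: "degree ?r \<le> N - d"
    using degree_laguerre_appell(1)[OF assms(1,2)] by (simp add: degree_map_poly degree_pcompose)
  have summand: "coeff ?r (N - k) * w ^ (N - k) * (of_real ?C / w ^ N) =
      of_real (poly (appell P (k - d)) 1 * scaled_ratio a N k) * (1 / w) ^ k" if k: "d \<le> k" "k \<le> N" for k
  proof -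
    define i where "i = N - k"
    let ?D = "fact i * pochhammer (1 + a) i"
    have D: "pochhammer (1 + a) i \<noteq> 0" using pochhammer_1_pos[OF assms(2), of i] by simp
    have ratio: "scaled_ratio a N k * ?D * real N ^ (2 * k) = fact N * pochhammer (1 + a) N"
      using scaled_ratio_eq[OF k(2) assms(3,2)] by (simp add: i_def)
    have N: "real N ^ (2 * N) = real N ^ (2 * k) * real N ^ (2 * i)"
    proof -
      have "2 * N = 2 * k + 2 * i" using k by (simp add: i_def)
      then show ?thesis by (simp only: power_add)
    qed
    have "coeff (pcompose ?q [:0, - (real N)\<^sup>2:]) i = poly (appell P (k - d)) 1 * real N ^ (2 * i) / ?D"
    proof -
      have "(- (real N)\<^sup>2) ^ i = (-1) ^ i * real N ^ (2 * i)"
        by (subst power_minus) (simp add: power_mult)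
      moreover have "i \<le> N - d" "N - d - i = k - d" using k by (auto simp: i_def)
      moreover have "(-1 :: real) ^ i * (-1) ^ i = 1" by (simp flip: power_mult_distrib)
      ultimately show ?thesis
        by (simp add: coeff_pcompose_linear coeff_laguerre_appell[OF assms(1)] mult_ac)
    qed
    then have "coeff (pcompose ?q [:0, - (real N)\<^sup>2:]) i * ?C = poly (appell P (k - d)) 1 * scaled_ratio a N k"
      using D assms(3) unfolding ratio[symmetric] N by simp
    then have c: "coeff ?r i * of_real ?C = of_real (poly (appell P (k - d)) 1 * scaled_ratio a N k)"
      by (simp only: coeff_map_poly of_real_0 of_real_mult[symmetric])
    have w: "w ^ i / w ^ N = (1 / w) ^ k"
      using k assms(5) by (simp add: i_def power_diff power_one_over field_simps)
    have "coeff ?r i * w ^ i * (of_real ?C / w ^ N) = coeff ?r i * of_real ?C * (w ^ i / w ^ N)"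
      by simp
    then show ?thesis unfolding c w by (simp only: i_def)
  qed
  have "poly ?r w = (\<Sum>i\<le>N. coeff ?r i * w ^ i)"
    unfolding poly_altdef
    using deg by (intro sum.mono_neutral_left) (auto simp: coeff_eq_0)
  also have "\<dots> = (\<Sum>k\<le>N. coeff ?r (N - k) * w ^ (N - k))"
    by (rule sum.reindex_bij_witness[of _ "\<lambda>k. N - k" "\<lambda>k. N - k"]) auto
  finally have "poly ?r w * (of_real ?C / w ^ N) = (\<Sum>k\<le>N. coeff ?r (N - k) * w ^ (N - k) * (of_real ?C / w ^ N))"
    by (simp only: sum_distrib_right)
  also have "\<dots> = (\<Sum>k\<le>N. of_real ((if k < d then 0 else poly (appell P (k - d)) 1) * scaled_ratio a N k) * (1 / w) ^ k)"
  proof (rule sum.cong)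
    fix k assume k: "k \<in> {..N}"
    show "coeff ?r (N - k) * w ^ (N - k) * (of_real ?C / w ^ N) =
        of_real ((if k < d then 0 else poly (appell P (k - d)) 1) * scaled_ratio a N k) * (1 / w) ^ k"
    proof (cases "k < d")
      case True
      then have "degree ?r < N - k" using deg k assms(4) by simp
      then show ?thesis using True by (simp add: coeff_eq_0)
    next
      case False
      then show ?thesis using summand[of k] k by simp
    qed
  qed simp
  finally show ?thesis .
qed

text \<open>
  On the boundary of the disc the limit $e^{1/w} P(w) (w+c) / w^{K+1}$ is at least a constant times
  $1 + |c|$ in modulus, because $|w + c|$ is bounded below by $|\mathrm{Im}\, w|$. The error is
  at most $\epsilon (1 + |c|)$, so the comparison holds for all real $c$ at once. The additional factor $w + c$
  has no zero in the disc.
\<close>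
lemma zcount_disc_scaled_laguerre_appell:
  fixes z0 :: complex and \<sigma> :: real
  assumes P: "P \<noteq> 0" and a: "a > -1" and \<sigma>: "\<sigma> = 1 \<or> \<sigma> = -1" and r: "0 < r"
    and disc: "cball z0 r \<subseteq> {w. 0 < \<sigma> * Im w}"
    and nz: "\<And>w. w \<in> sphere z0 r \<Longrightarrow> poly (map_poly of_real P) w \<noteq> 0"
  shows "\<exists>n0. \<forall>n\<ge>n0. \<forall>c.
    zcount (ball z0 r) (map_poly complex_of_real
      (pcompose (laguerre_appell a ([:c, 1:] * P) (Suc n)) [:0, - (real (Suc n))\<^sup>2:])) =
    zcount (ball z0 r) (map_poly complex_of_real P)"
proof -
  let ?P = "map_poly complex_of_real P" and ?K = "degree P"
  let ?s = "{w. 0 < \<sigma> * Im w}"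
  let ?E = "\<lambda>w. exp (1 / w) * poly ?P w / w ^ ?K"
  have s0: "w \<noteq> 0" if "w \<in> ?s" for w using that by auto
  have s_open: "open ?s" by (intro open_Collect_less continuous_intros)
  have s_conn: "connected ?s"
  proof -
    have "convex ?s"
      using \<sigma> convex_halfspace_Im_gt[of 0] convex_halfspace_Im_lt[of 0] by (elim disjE) simp_all
    then show ?thesis by (rule convex_connected)
  qed
  have sub: "sphere z0 r \<subseteq> cball z0 r" by auto
  obtain w0 where w0: "w0 \<in> cball z0 r" "\<And>w. w \<in> cball z0 r \<Longrightarrow> \<sigma> * Im w0 \<le> \<sigma> * Im w"
  proof -
    have "\<exists>w0\<in>cball z0 r. \<forall>w\<in>cball z0 r. \<sigma> * Im w0 \<le> \<sigma> * Im w"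
      using r by (intro continuous_attains_inf continuous_intros compact_cball) auto
    then show ?thesis using that by blast
  qed
  \<comment> \<open>All constants depend on the disc and on $P$ only: $\eta$ bounds $|\mathrm{Im}\,w|$ from below, $\rho$ bounds $|w|$ from above,
      and $\delta$ bounds the limit function for $P$ from below on the boundary.\<close>
  define \<eta> where "\<eta> = \<sigma> * Im w0"
  have \<eta>: "\<eta> > 0" using w0(1) disc by (auto simp: \<eta>_def)
  have Im: "\<eta> \<le> \<bar>Im w\<bar>" if "w \<in> cball z0 r" for w
    using w0(2)[OF that] \<sigma> unfolding \<eta>_def by auto
  define \<rho> where "\<rho> = norm z0 + r"
  have \<rho>: "\<rho> > 0" using r unfolding \<rho>_def by (intro add_nonneg_pos) auto
  have norm_le: "norm w \<le> \<rho>" if "w \<in> cball z0 r" for w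
    using that norm_triangle_ineq2[of w z0] by (simp add: \<rho>_def dist_norm norm_minus_commute)
  have "continuous_on (sphere z0 r) (\<lambda>w. norm (?E w))"
  proof (intro continuous_intros ballI)
    fix w assume "w \<in> sphere z0 r"
    then have "w \<noteq> 0" using s0 sub disc by blast
    then show "w \<noteq> 0" "w ^ degree P \<noteq> 0" by simp_all
  qed
  then obtain w1 where w1: "w1 \<in> sphere z0 r" "\<And>w. w \<in> sphere z0 r \<Longrightarrow> norm (?E w1) \<le> norm (?E w)"
  proof -
    have "sphere z0 r \<noteq> {}" using r by simp
    then have "\<exists>w1\<in>sphere z0 r. \<forall>w\<in>sphere z0 r. norm (?E w1) \<le> norm (?E w)"
      using \<open>continuous_on (sphere z0 r) _\<close> by (intro continuous_attains_inf compact_sphere)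
    then show ?thesis using that by blast
  qed
  define \<delta> where "\<delta> = norm (?E w1)"
  have \<delta>: "\<delta> > 0"
  proof -
    have "w1 \<noteq> 0" using s0 sub disc w1(1) by blast
    then show ?thesis using nz[OF w1(1)] unfolding \<delta>_def by simp
  qed
  define \<kappa> where "\<kappa> = 1 + (1 + \<rho>) / \<eta>"
  have \<kappa>: "\<kappa> > 0" using \<rho> \<eta> unfolding \<kappa>_def by (intro add_pos_pos divide_pos_pos) auto
  have shift: "1 + \<bar>c\<bar> \<le> norm (w + of_real c) * \<kappa>" if "w \<in> cball z0 r" for w c
  proof -
    have "\<eta> \<le> norm (w + of_real c)" using Im[OF that] abs_Im_le_cmod[of "w + of_real c"] by simp
    then have "1 \<le> norm (w + of_real c) / \<eta>" using \<eta> by simp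
    then have "(1 + \<rho>) * 1 \<le> (1 + \<rho>) * (norm (w + of_real c) / \<eta>)" using \<rho> by (intro mult_left_mono) auto
    moreover have "\<bar>c\<bar> \<le> norm (w + of_real c) + norm w"
      using norm_triangle_ineq4[of "w + of_real c" w] by simp
    ultimately show ?thesis using norm_le[OF that] by (simp add: \<kappa>_def distrib_left mult.commute)
  qed
  define \<epsilon> where "\<epsilon> = \<delta> / (\<kappa> * \<rho>)"
  have \<epsilon>: "\<epsilon> > 0" using \<delta> \<kappa> \<rho> by (simp add: \<epsilon>_def)
  \<comment> \<open>Coefficients of the two limit series, for the index $N$ ($d = 0$) and the index $N - 1$ ($d = 1$).\<close>
  define b where "b d k = (if k < d then 0 else poly (appell P (k - d)) 1)" for d k :: nat
  have b0: "b 0 k = poly (appell P k) 1" and b1: "b 1 0 = 0" "b 1 (Suc k) = poly (appell P k) 1" for k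
    by (simp_all add: b_def)
  have sum0: "summable (\<lambda>k. \<bar>b 0 k\<bar> * t ^ k)" if "t > 0" for t
    using appell_1_series(1)[of P t] that by (simp add: b0)
  have sum1: "summable (\<lambda>k. \<bar>b 1 k\<bar> * t ^ k)" if "t > 0" for t
  proof -
    have "summable (\<lambda>k. t * (\<bar>b 0 k\<bar> * t ^ k))" using sum0[OF that] by (rule summable_mult)
    then have "summable (\<lambda>k. \<bar>b 1 (Suc k)\<bar> * t ^ Suc k)" by (simp add: b0 b1 mult_ac del: One_nat_def)
    then show ?thesis by (subst summable_Suc_iff[symmetric])
  qed
  have lim0: "(\<Sum>k. of_real (b 0 k) * (1 / w) ^ k) = ?E w" if "w \<noteq> 0" for w
    using appell_1_series(2)[OF that, of P] by (simp add: b0 sums_iff)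
  have lim1: "(\<Sum>k. of_real (b 1 k) * (1 / w) ^ k) = ?E w / w" if "w \<noteq> 0" for w
  proof -
    have "(\<lambda>k. (1 / w) * (of_real (b 0 k) * (1 / w) ^ k)) sums ((1 / w) * ?E w)"
      using appell_1_series(2)[OF that, of P] by (intro sums_mult) (simp add: b0)
    then have "(\<lambda>k. of_real (b 1 (Suc k)) * (1 / w) ^ Suc k) sums ((1 / w) * ?E w)"
      by (simp add: b0 b1 mult_ac del: One_nat_def)
    then have "(\<lambda>k. of_real (b 1 k) * (1 / w) ^ k) sums ((1 / w) * ?E w + of_real (b 1 0) * (1 / w) ^ 0)"
      by (rule sums_Suc)
    then show ?thesis by (simp add: sums_iff b1 del: One_nat_def)
  qed
  have T: "1 / \<eta> > 0" using \<eta> by simp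
  obtain n0 where n0: "\<And>N u. N \<ge> n0 \<Longrightarrow> norm u \<le> 1 / \<eta> \<Longrightarrow>
      norm ((\<Sum>k\<le>N. of_real (b 0 k * scaled_ratio a N k) * u ^ k) - (\<Sum>k. of_real (b 0 k) * u ^ k)) < \<epsilon> \<and>
      norm ((\<Sum>k\<le>N. of_real (b 1 k * scaled_ratio a N k) * u ^ k) - (\<Sum>k. of_real (b 1 k) * (u::complex) ^ k)) < \<epsilon>"
    using eventually_conj[OF scaled_ratio_uniform[OF a sum0 T \<epsilon>] scaled_ratio_uniform[OF a sum1 T \<epsilon>]]
    unfolding eventually_sequentially by blast
  show ?thesis
  proof (intro exI[of _ n0] allI impI)
    fix n c assume n: "n0 \<le> n"
    define N where "N = Suc n"
    have N: "N > 0" "n0 \<le> N" "N - 1 = n" "1 \<le> N" using n by (auto simp: N_def)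
    define C where "C = fact N * pochhammer (1 + a) N / real N ^ (2 * N)"
    have C: "C > 0" using pochhammer_1_pos[OF a] N by (simp add: C_def)
    define Q where "Q d = map_poly complex_of_real (pcompose (laguerre_appell a P (N - d)) [:0, - (real N)\<^sup>2:])" for d
    let ?Pc = "[:c, 1:] * P"
    let ?q = "map_poly complex_of_real (pcompose (laguerre_appell a ?Pc N) [:0, - (real N)\<^sup>2:])"
    let ?p = "?P * [:of_real c, 1:]"
    let ?e1 = "\<lambda>w::complex. exp (1 / w) / w ^ Suc ?K" and ?e2 = "\<lambda>w. of_real C / w ^ N"
    have Pc: "?Pc \<noteq> 0" using P by (simp del: mult_pCons_left)
    have P0: "?P \<noteq> 0" using P by (simp add: map_poly_eq_0_iff)
    have q_split: "poly ?q w = poly (Q 0) w + of_real c * poly (Q 1) w" for w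
    proof -
      have "?q = Q 0 + smult (of_real c) (Q 1)"
        unfolding N_def laguerre_appell_linear_factor pcompose_add pcompose_smult Q_def
        by (rule poly_eqI) (simp add: coeff_map_poly)
      then show ?thesis by simp
    qed
    have "zcount (ball z0 r) ?q = zcount (ball z0 r) ?p"
    proof (rule zcount_rouche[OF _ _ s_open s_conn r disc])
      show "?p \<noteq> 0" using P0 by (simp del: mult_pCons_right)
      show "?q \<noteq> 0"
        using degree_laguerre_appell(2)[OF Pc a] N
        by (simp add: map_poly_eq_0_iff pcompose_linear_nonzero)
      show "?e1 holomorphic_on ?s" "?e2 holomorphic_on ?s"
        using s0 by (auto intro!: holomorphic_intros)
      show "?e1 w \<noteq> 0" "?e2 w \<noteq> 0" if "w \<in> ?s" for w using s0[OF that] C by auto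
      fix w assume w: "w \<in> sphere z0 r"
      then have wc: "w \<in> cball z0 r" and w0: "w \<noteq> 0" using sub disc s0 by blast+
      have u: "norm (1 / w) \<le> 1 / \<eta>"
        using Im[OF wc] abs_Im_le_cmod[of w] \<eta> by (simp add: norm_divide frac_le)
      define S where "S d = (\<Sum>k\<le>N. of_real (b d k * scaled_ratio a N k) * (1 / w) ^ k)" for d
      have S: "poly (Q d) w * ?e2 w = S d" if "d \<le> N" for d
        unfolding Q_def C_def S_def b_def
        by (rule poly_scaled_laguerre_appell[OF P a N(1) that w0])
      have S0: "norm (S 0 - ?E w) < \<epsilon>" and S1: "norm (S 1 - ?E w / w) < \<epsilon>"
        using n0[OF N(2) u] lim0[OF w0] lim1[OF w0] by (simp_all only: S_def)
      have q: "poly ?q w * ?e2 w = S 0 + of_real c * S 1"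
        unfolding q_split S[OF le0, symmetric] S[OF N(4), symmetric]
        by (simp only: distrib_right mult.assoc)
      have p: "poly ?p w * ?e1 w = ?E w + of_real c * (?E w / w)"
        using w0 by (simp add: field_simps)
      have p': "poly ?p w * ?e1 w = ?E w * ((w + of_real c) / w)"
        using w0 by (simp add: field_simps)
      have "norm (poly ?q w * ?e2 w - poly ?p w * ?e1 w) = norm ((S 0 - ?E w) + of_real c * (S 1 - ?E w / w))"
        unfolding q p by (simp add: algebra_simps)
      also have "\<dots> \<le> norm (S 0 - ?E w) + \<bar>c\<bar> * norm (S 1 - ?E w / w)"
        by (rule order_trans[OF norm_triangle_ineq]) (simp add: norm_mult)
      also have "\<dots> < \<epsilon> + \<bar>c\<bar> * \<epsilon>"
        using S0 S1 by (intro add_less_le_mono mult_left_mono) auto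
      also have "\<dots> = \<epsilon> * (1 + \<bar>c\<bar>)" by (simp add: algebra_simps)
      also have "\<dots> \<le> \<epsilon> * (norm (w + of_real c) * \<kappa>)"
        using shift[OF wc] \<epsilon> by (intro mult_left_mono) auto
      also have "\<dots> = \<delta> * (norm (w + of_real c) / \<rho>)" using \<kappa> \<rho> by (simp add: \<epsilon>_def)
      also have "\<dots> \<le> norm (?E w) * (norm (w + of_real c) / norm w)"
        using w1(2)[OF w] norm_le[OF wc] w0 \<rho>
        by (intro mult_mono divide_left_mono) (auto simp: \<delta>_def)
      also have "\<dots> = norm (poly ?p w * ?e1 w)"
        unfolding p' by (simp add: norm_mult norm_divide)
      finally show "norm (poly ?q w * ?e2 w - poly ?p w * ?e1 w) < norm (poly ?p w * ?e1 w)" .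
    qed
    also have "\<dots> = zcount (ball z0 r) ?P + zcount (ball z0 r) [:- (- of_real c), 1:]"
      using P0 by (subst zcount_mult) (simp_all del: mult_pCons_right)
    also have "zcount (ball z0 r) [:- (- complex_of_real c), 1:] = 0"
    proof -
      have "- complex_of_real c \<notin> ?s" by simp
      then have "- complex_of_real c \<notin> ball z0 r" using disc ball_subset_cball[of z0 r] by blast
      then show ?thesis by (simp only: zcount_linear if_False)
    qed
    finally show "zcount (ball z0 r) (map_poly complex_of_real
        (pcompose (laguerre_appell a ([:c, 1:] * P) (Suc n)) [:0, - (real (Suc n))\<^sup>2:])) =
      zcount (ball z0 r) ?P" by (simp add: N_def)
  qed
qed

text \<open>
  Discs touching the real axis at $0$ exhaust the half-plane as their radius $\rho$ grows: $x$ lies inside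
  once $|x|^2 < 2 \rho\, |\mathrm{Im}\, x|$.
\<close>
lemma disc_in_half_plane:
  fixes \<sigma> :: real
  assumes "finite X" "X \<subseteq> {w. 0 < \<sigma> * Im w}" "\<sigma> = 1 \<or> \<sigma> = -1"
  obtains z0 r where "0 < r" "X \<subseteq> ball z0 r" "cball z0 r \<subseteq> {w. 0 < \<sigma> * Im w}"
proof -
  define \<rho> where "\<rho> = 1 + (\<Sum>x\<in>X. (norm x)\<^sup>2 / (2 * (\<sigma> * Im x)))"
  define z0 where "z0 = Complex 0 (\<sigma> * \<rho>)"
  have \<sigma>2: "\<sigma> * \<sigma> = 1" using assms(3) by auto
  have nn: "0 \<le> (norm x)\<^sup>2 / (2 * (\<sigma> * Im x))" if "x \<in> X" for x
    using that assms(2) by (intro divide_nonneg_nonneg) auto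
  have \<rho>: "\<rho> > 0" unfolding \<rho>_def by (intro add_pos_nonneg sum_nonneg nn) auto
  have less: "norm (z0 - x) < \<rho>" if x: "x \<in> X" for x
  proof -
    have pos: "\<sigma> * Im x > 0" using x assms(2) by auto
    have "(norm x)\<^sup>2 / (2 * (\<sigma> * Im x)) \<le> (\<Sum>x\<in>X. (norm x)\<^sup>2 / (2 * (\<sigma> * Im x)))"
      using assms(1) x nn by (intro member_le_sum) auto
    then have "(norm x)\<^sup>2 / (2 * (\<sigma> * Im x)) < \<rho>" by (simp add: \<rho>_def)
    then have "(norm x)\<^sup>2 < \<rho> * (2 * (\<sigma> * Im x))" using pos by (simp add: divide_less_eq)
    moreover have "(norm (z0 - x))\<^sup>2 = (\<sigma> * \<sigma>) * \<rho>\<^sup>2 - \<rho> * (2 * (\<sigma> * Im x)) + (norm x)\<^sup>2"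
      unfolding cmod_power2 by (simp add: z0_def power2_eq_square algebra_simps)
    ultimately have "(norm (z0 - x))\<^sup>2 < \<rho>\<^sup>2" unfolding \<sigma>2 by linarith
    then show ?thesis using \<rho> by (rule power2_less_imp_less[OF _ less_imp_le])
  qed
  define m where "m = Max (insert 0 ((\<lambda>x. norm (z0 - x)) ` X))"
  have m: "0 \<le> m" "m < \<rho>" "\<And>x. x \<in> X \<Longrightarrow> norm (z0 - x) \<le> m"
    using assms(1) \<rho> less by (auto simp: m_def)
  define r where "r = (m + \<rho>) / 2"
  have r: "0 < r" "m < r" "r < \<rho>" using m \<rho> by (auto simp: r_def)
  show ?thesis
  proof (rule that[of r z0])
    show "X \<subseteq> ball z0 r" using m(3) r by (force simp: dist_norm)
    show "cball z0 r \<subseteq> {w. 0 < \<sigma> * Im w}"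
    proof
      fix w assume "w \<in> cball z0 r"
      then have "norm (z0 - w) \<le> r" by (simp add: dist_norm)
      then have "\<bar>Im (z0 - w)\<bar> < \<rho>" using abs_Im_le_cmod[of "z0 - w"] r by linarith
      then have "\<bar>\<sigma> * \<rho> - Im w\<bar> < \<rho>" by (simp add: z0_def)
      then have "0 < \<sigma> * Im w" using assms(3) by auto
      then show "w \<in> {w. 0 < \<sigma> * Im w}" by simp
    qed
  qed (rule r)
qed

lemma half_plane_zeros_le:
  fixes \<sigma> :: real
  assumes P: "P \<noteq> 0" and a: "a > -1" and \<sigma>: "\<sigma> = 1 \<or> \<sigma> = -1"
  shows "\<exists>n0. \<forall>n\<ge>n0. \<forall>c.
    zcount {w. 0 < \<sigma> * Im w} (map_poly complex_of_real P) \<le>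
    zcount {w. 0 < \<sigma> * Im w} (map_poly complex_of_real
      (pcompose (laguerre_appell a ([:c, 1:] * P) (Suc n)) [:0, - (real (Suc n))\<^sup>2:]))"
proof -
  let ?P = "map_poly complex_of_real P" and ?s = "{w. 0 < \<sigma> * Im w}"
  let ?X = "{w \<in> ?s. poly ?P w = 0}"
  have P0: "?P \<noteq> 0" using P by (simp add: map_poly_eq_0_iff)
  have fin: "finite ?X" by (rule finite_subset[OF _ poly_roots_finite[OF P0]]) auto
  obtain z0 r where zr: "0 < r" "?X \<subseteq> ball z0 r" "cball z0 r \<subseteq> ?s"
    by (rule disc_in_half_plane[OF fin _ \<sigma>]) auto
  have "poly ?P w \<noteq> 0" if "w \<in> sphere z0 r" for w
  proof
    assume "poly ?P w = 0"
    moreover have "w \<in> cball z0 r" using that by simp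
    ultimately have "w \<in> ball z0 r" using zr(2,3) by blast
    then show False using that by simp
  qed
  from zcount_disc_scaled_laguerre_appell[OF P a \<sigma> zr(1,3) this]
  obtain n0 where n0: "\<forall>n\<ge>n0. \<forall>c.
    zcount (ball z0 r) (map_poly complex_of_real
      (pcompose (laguerre_appell a ([:c, 1:] * P) (Suc n)) [:0, - (real (Suc n))\<^sup>2:])) =
    zcount (ball z0 r) ?P" by blast
  have "zcount ?s ?P = (\<Sum>w\<in>?X. order w ?P)" using fin P0 by (intro zcount_eq_sum) auto
  also have "\<dots> = zcount (ball z0 r) ?P"
  proof (rule zcount_eq_sum[OF P0 fin zr(2), symmetric])
    show "{w \<in> ball z0 r. poly ?P w = 0} \<subseteq> ?X" using zr(3) ball_subset_cball by blast
  qed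
  finally have eq: "zcount ?s ?P = zcount (ball z0 r) ?P" .
  have sub: "ball z0 r \<subseteq> ?s" using zr(3) ball_subset_cball by blast
  show ?thesis
    unfolding eq
  proof (intro exI[of _ n0] allI impI)
    fix n c assume "n0 \<le> n"
    from n0[rule_format, OF this, of c, symmetric]
    show "zcount (ball z0 r) ?P \<le> zcount ?s (map_poly complex_of_real
      (pcompose (laguerre_appell a ([:c, 1:] * P) (Suc n)) [:0, - (real (Suc n))\<^sup>2:]))"
      using zcount_mono[OF sub] by (rule ord_eq_le_trans)
  qed
qed

lemma nonreal_zeros_split:
  assumes "p \<noteq> 0"
  shows "zcount {w. 0 < 1 * Im w} (map_poly complex_of_real p) +
         zcount {w. 0 < -1 * Im w} (map_poly complex_of_real p) + zcount UNIV p = degree p"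
proof -
  have un: "{w. 0 < 1 * Im w} \<union> {w. 0 < -1 * Im w} = - \<real>"
    by (auto simp: complex_is_Real_iff)
  have disj: "{w. 0 < 1 * Im w} \<inter> {w. 0 < -1 * Im w} = {}" by auto
  have "num_zeros_in (- \<real>) p = zcount {w. 0 < 1 * Im w} (map_poly complex_of_real p) +
         zcount {w. 0 < -1 * Im w} (map_poly complex_of_real p)"
    unfolding num_zeros_in_eq_zcount un[symmetric] by (rule zcount_Un[OF disj])
  with num_nonreal[OF assms] show ?thesis by simp
qed

lemma laguerre_appell_nonreal_ge:
  assumes P: "P \<noteq> 0" and a: "a > -1"
  shows "\<exists>n0. \<forall>n\<ge>n0. \<forall>c.
    zcount UNIV (laguerre_appell a ([:c, 1:] * P) (Suc n)) + degree P \<le> Suc n + zcount UNIV P"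
proof -
  let ?Q = "\<lambda>n c. map_poly complex_of_real
    (pcompose (laguerre_appell a ([:c, 1:] * P) (Suc n)) [:0, - (real (Suc n))\<^sup>2:])"
  from half_plane_zeros_le[OF P a disjI1[OF refl]]
  obtain n1 where n1: "\<forall>n\<ge>n1. \<forall>c.
      zcount {w. 0 < 1 * Im w} (map_poly complex_of_real P) \<le> zcount {w. 0 < 1 * Im w} (?Q n c)" ..
  from half_plane_zeros_le[OF P a disjI2[OF refl]]
  obtain n2 where n2: "\<forall>n\<ge>n2. \<forall>c.
      zcount {w. 0 < -1 * Im w} (map_poly complex_of_real P) \<le> zcount {w. 0 < -1 * Im w} (?Q n c)" ..
  show ?thesis
  proof (intro exI[of _ "max n1 n2"] allI impI)
    fix n c assume n: "max n1 n2 \<le> n"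
    have Pc: "[:c, 1:] * P \<noteq> 0" using P by (simp del: mult_pCons_left)
    define q where "q = laguerre_appell a ([:c, 1:] * P) (Suc n)"
    \<comment> \<open>Real scaling preserves the number of real zeros and hence that of the non-real ones.\<close>
    define t where "t = pcompose q [:0, - (real (Suc n))\<^sup>2:]"
    have q: "q \<noteq> 0" "degree q = Suc n" unfolding q_def by (rule degree_laguerre_appell[OF Pc a])+
    have nz: "- (real (Suc n))\<^sup>2 \<noteq> 0" by simp
    have t: "t \<noteq> 0" unfolding t_def by (rule pcompose_linear_nonzero[OF q(1) nz])
    have dt: "degree t = Suc n"
    proof -
      have "degree [:0, - (real (Suc n))\<^sup>2:] = 1" by (simp only: degree_pCons_eq_if) simp
      then show ?thesis unfolding t_def degree_pcompose q(2) by simp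
    qed
    have surj: "range (\<lambda>x. 0 + - (real (Suc n))\<^sup>2 * x) = UNIV"
    proof -
      have "y = 0 + - (real (Suc n))\<^sup>2 * (y / - (real (Suc n))\<^sup>2)" for y using nz by simp
      then show ?thesis by blast
    qed
    have R: "zcount UNIV t = zcount UNIV q"
      unfolding t_def zcount_pcompose_linear[OF q(1) nz] surj ..
    show "zcount UNIV (laguerre_appell a ([:c, 1:] * P) (Suc n)) + degree P \<le> Suc n + zcount UNIV P"
      using n1[rule_format, of n c] n2[rule_format, of n c] n nonreal_zeros_split[OF P] nonreal_zeros_split[OF t] R dt
      unfolding q_def[symmetric] t_def[symmetric] by linarith
  qed
qed

section \<open>Exact counts and interlacing for the Laguerre combinations\<close>

lemma laguerre_appell_eventually_exact:
  assumes P: "P \<noteq> 0" and a: "a > -1"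
  obtains n0 where "n0 \<ge> degree P"
    "\<And>n. n \<ge> n0 \<Longrightarrow> zcount UNIV (laguerre_appell a P n) + degree P = n + zcount UNIV P"
    "\<And>n c. n \<ge> n0 \<Longrightarrow>
       zcount UNIV (laguerre_appell a ([:c, 1:] * P) (Suc n)) + degree P = Suc n + zcount UNIV P"
proof -
  obtain n1 where n1: "\<forall>n\<ge>n1. \<forall>c.
      zcount UNIV (laguerre_appell a ([:c, 1:] * P) (Suc n)) + degree P \<le> Suc n + zcount UNIV P"
    using laguerre_appell_nonreal_ge[OF P a] ..
  have pencil: "zcount UNIV (laguerre_appell a ([:c, 1:] * P) (Suc n)) + degree P = Suc n + zcount UNIV P"
    if n: "n \<ge> max n1 (degree P)" for n c
  proof -
    have Pc: "[:c, 1:] * P \<noteq> 0" using P by (simp del: mult_pCons_left)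
    have "degree ([:c, 1:] * P) = Suc (degree P)" using P by (subst degree_mult_eq) auto
    moreover have "zcount UNIV ([:c, 1:] * P) = Suc (zcount UNIV P)"
      using zcount_mult[OF Pc, of UNIV] zcount_linear[of UNIV "- c"] by simp
    ultimately show ?thesis
      using laguerre_appell_nonreal_le[OF Pc a, of "Suc n"] n1[rule_format, of n c] n by simp
  qed
  have "zcount UNIV (laguerre_appell a P n) + degree P = n + zcount UNIV P"
    if n: "n \<ge> Suc (max n1 (degree P))" for n
  proof -
    obtain m where m: "n = Suc m" "m \<ge> max n1 (degree P)" using n by (cases n) auto
    \<comment> \<open>The member $c = 0$ of the pencil is the polynomial with index $m + 1$.\<close>
    show ?thesis using pencil[OF m(2), of 0] unfolding laguerre_appell_linear_factor m(1) by simp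
  qed
  then show ?thesis
    by (rule that[of "Suc (max n1 (degree P))", rotated]) (assumption, rule pencil, linarith+)
qed

theorem theorem1p6:
  fixes K :: nat and \<gamma> :: "nat \<Rightarrow> real" and \<alpha> :: real
  fixes P :: "real poly" and q :: "nat \<Rightarrow> real poly" and Nnr Npos :: nat
  assumes "K > 0" and "\<gamma> 0 = 1" and "\<gamma> K \<noteq> 0" and "\<alpha> > -1"
  defines "P \<equiv> gamma_poly K \<gamma>"
  defines "q \<equiv> laguerre_comb K \<gamma> \<alpha>"
  defines "Nnr \<equiv> num_zeros_in (- \<real>) P"
  defines "Npos \<equiv> num_zeros_in pos_reals P"
  shows
    "(Nnr = 0 \<longleftrightarrow> (\<forall>n. \<forall>z \<in># czeros (q n). z \<in> \<real>)) \<and>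
     (Nnr = 0 \<longrightarrow>
        (\<forall>n. \<forall>z \<in># czeros (q n). count (czeros (q n)) z = 1) \<and>
        (\<forall>n. interlaces (real_zeros (q (Suc n))) (real_zeros (q n))) \<and>
        (\<exists>n0. \<forall>n\<ge>n0. num_zeros_in neg_reals (q n) = Npos)) \<and>
     (Nnr > 0 \<longrightarrow>
        (\<exists>n0. \<forall>n\<ge>n0.
           num_zeros_in \<real> (q n) + Nnr = n \<and>
           num_zeros_in neg_reals (q n) = Npos \<and>
           (\<alpha> \<ge> 0 \<longrightarrow> interlaces (real_zeros (q (Suc n))) (real_zeros (q n)))))"
proof -
  have a: "\<alpha> > -1" by fact
  have q: "q n = laguerre_appell \<alpha> P n" for n
    unfolding q_def P_def by (rule laguerre_comb_eq) fact+
  have degP: "degree P = K" unfolding P_def by (rule degree_gamma_poly) fact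
  have leadP: "lead_coeff P = 1"
    using assms(2) unfolding degP by (simp add: P_def coeff_gamma_poly)
  then have P: "P \<noteq> 0" by auto
  have P0: "poly P 0 \<noteq> 0"
    using assms(3) by (simp add: poly_0_coeff_0 P_def coeff_gamma_poly)
  have Pc: "[:c, 1:] * P \<noteq> 0" for c using P by (simp del: mult_pCons_left)
  have degPc: "degree ([:c, 1:] * P) = Suc K" for c
    using P degP by (subst degree_mult_eq) auto
  have RPc: "zcount UNIV ([:c, 1:] * P) = Suc (zcount UNIV P)" for c
    using zcount_mult[OF Pc, of UNIV c] zcount_linear[of UNIV "- c"] by simp
  have q0: "q n \<noteq> 0" and deg: "degree (q n) = n"
    and lead: "lead_coeff (q n) = (-1) ^ n / (fact n * pochhammer (1 + \<alpha>) n)" for n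
    using degree_laguerre_appell[OF P a, of n] leadP by (simp_all add: q)
  have lead_pos: "lead_coeff (q n) * (-1) ^ n > 0" for n
  proof -
    have "lead_coeff (q n) * (-1) ^ n = ((-1) ^ n * (-1) ^ n) / (fact n * pochhammer (1 + \<alpha>) n)"
      by (simp add: lead)
    moreover have "(-1 :: real) ^ n * (-1) ^ n = 1" by (simp flip: power_mult_distrib)
    ultimately show ?thesis using pochhammer_1_pos[OF a, of n] by simp
  qed
  have pencil: "q (Suc n) + smult c (q n) = laguerre_appell \<alpha> ([:c, 1:] * P) (Suc n)" for n c
    unfolding q laguerre_appell_linear_factor ..
  have at0: "poly (q n) 0 = poly (appell P n) 1" for n
    using coeff_laguerre_appell[OF P, of \<alpha> n 0] by (simp add: q poly_0_coeff_0)
  have num_real: "num_zeros_in \<real> (q n) = zcount UNIV (q n)" for n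
    using zcount_map_poly_of_real[OF q0, of UNIV n] by (simp add: num_zeros_in_eq_zcount Reals_def)
  have num_neg: "num_zeros_in neg_reals (q n) = zcount {..<0} (q n)" for n
    using zcount_map_poly_of_real[OF q0, of "{..<0}" n] by (simp add: num_zeros_in_eq_zcount)
  have Npos: "Npos = zcount {0<..} P"
    using zcount_map_poly_of_real[OF P, of "{0<..}"] by (simp add: Npos_def num_zeros_in_eq_zcount)
  have Nnr: "Nnr + zcount UNIV P = K"
    using num_nonreal[OF P] by (simp add: Nnr_def degP)
  have real_iff: "(\<forall>z \<in># czeros (q n). z \<in> \<real>) \<longleftrightarrow> zcount UNIV (q n) = n" for n
  proof -
    have "(\<forall>z \<in># czeros (q n). z \<in> \<real>) \<longleftrightarrow> num_zeros_in (- \<real>) (q n) = 0"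
      by (simp add: num_zeros_in_def Ball_def)
    then show ?thesis using num_nonreal[OF q0, of n] by (auto simp: deg)
  qed
  obtain n1 where n1: "n1 \<ge> K"
    "\<And>n. n \<ge> n1 \<Longrightarrow> zcount UNIV (q n) + K = n + zcount UNIV P"
    "\<And>n c. n \<ge> n1 \<Longrightarrow>
       zcount UNIV (laguerre_appell \<alpha> ([:c, 1:] * P) (Suc n)) + K = Suc n + zcount UNIV P"
    using laguerre_appell_eventually_exact[OF P a] unfolding degP q by blast
  obtain n2 where n2: "\<And>n y. n \<ge> n2 \<Longrightarrow> y \<in> {0<..1} \<Longrightarrow> poly (appell P n) y \<noteq> 0"
    using appell_no_zero_Ioc[OF P0] by blast
  define n0 where "n0 = max n1 n2"
  have neg: "num_zeros_in neg_reals (q n) = Npos" if n: "n \<ge> n0" for n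
  proof -
    have nK: "n \<ge> degree P" "n \<ge> n1" "n \<ge> n2" using n n1(1) by (auto simp: n0_def degP)
    have ex: "zcount UNIV (laguerre_appell \<alpha> P n) + degree P = zcount UNIV P + n"
      using n1(2)[OF nK(2)] by (simp add: q degP)
    have "{0<..1} \<union> {1<..} = {0::real<..}" "{0<..1} \<inter> {1<..} = ({} :: real set)" by auto
    then have "zcount {0<..} (appell P n) = zcount {0<..1} (appell P n) + zcount {1<..} (appell P n)"
      by (metis zcount_Un)
    moreover have "zcount {0<..1} (appell P n) = 0"
    proof -
      have "{y \<in> {0<..1}. poly (appell P n) y = 0} \<subseteq> {}" using n2[OF nK(3)] by blast
      then show ?thesis using zcount_eq_sum[OF degree_appell(2)[OF P], of "{}" "{0<..1}"] by simp
    qed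
    ultimately show ?thesis
      using laguerre_appell_exact(2,3)[OF P a nK(1) ex, folded q] by (simp only: num_neg Npos)
  qed
  have real_case: "zcount UNIV (q n) = n" "order x (q n) \<le> 1" if "Nnr = 0" for n x
    unfolding q using laguerre_appell_real_rooted[OF P a] that Nnr by (simp_all add: degP)
  have simple: "count (czeros (q n)) z = 1" if "Nnr = 0" "z \<in># czeros (q n)" for n z
  proof -
    have "z \<in> \<real>" using real_iff[of n] real_case(1)[OF that(1)] that(2) by blast
    then obtain x where z: "z = of_real x" by (auto elim: Reals_cases)
    have nz: "map_poly complex_of_real (q n) \<noteq> 0" using q0 by (simp add: map_poly_eq_0_iff)
    then have c: "count (czeros (q n)) z = order x (q n)"
      unfolding z czeros_def by (simp add: order_map_poly_of_real[OF q0])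
    moreover have "count (czeros (q n)) z \<noteq> 0" using that(2) by simp
    ultimately show ?thesis using real_case(2)[OF that(1), of x n] by simp
  qed
  have inter0: "interlaces (real_zeros (q (Suc n))) (real_zeros (q n))" if N: "Nnr = 0" for n
  proof (rule interlaces_of_simple_pencil[OF deg deg lead_pos lead_pos])
    show "order x (q (Suc n) + smult c (q n)) \<le> 1" for x c
      unfolding pencil using laguerre_appell_real_rooted(2)[OF Pc a] Nnr N degPc RPc by simp
    show "order x (q n) \<le> 1" for x by (rule real_case(2)[OF N])
    show "\<not> (poly (q (Suc n)) 0 = 0 \<and> poly (q n) 0 = 0)"
    proof
      assume "poly (q (Suc n)) 0 = 0 \<and> poly (q n) 0 = 0"
      \<comment> \<open>Two consecutive polynomials vanishing at 0 mean a double zero at 1 in the Appell sequence.\<close>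
      then have z: "poly (appell P (Suc n)) 1 = 0" "poly (pderiv (appell P (Suc n))) 1 = 0"
        by (simp_all add: at0 pderiv_appell)
      have "order 1 (appell P (Suc n)) \<le> 1"
        using appell_real_rooted[OF P] Nnr N degP by simp
      then show False
        using order_le_1_imp_pderiv_nonzero[OF degree_appell(2)[OF P] _ z(1)] z(2) by simp
    qed
  qed
  have inter: "interlaces (real_zeros (q (Suc n))) (real_zeros (q n))" if n: "n \<ge> n0" for n
  proof (rule interlaces_of_simple_pencil[OF deg deg lead_pos lead_pos])
    have nK: "n \<ge> K" "n \<ge> n1" "n \<ge> n2" using n n1(1) by (auto simp: n0_def)
    have q_at0: "poly (q n) 0 \<noteq> 0" unfolding at0 using n2[OF nK(3)] by simp
    show "order x (q (Suc n) + smult c (q n)) \<le> 1" if "x \<noteq> 0" for x c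
      unfolding pencil
    proof (rule laguerre_appell_exact(1)[OF Pc a _ _ that])
      show "degree ([:c, 1:] * P) \<le> Suc n" using nK degPc by simp
      show "zcount UNIV (laguerre_appell \<alpha> ([:c, 1:] * P) (Suc n)) + degree ([:c, 1:] * P) =
          zcount UNIV ([:c, 1:] * P) + Suc n"
        using n1(3)[OF nK(2), of c] unfolding degPc RPc by simp
    qed
    show "order x (q n) \<le> 1" for x
    proof (cases "x = 0")
      case True
      then show ?thesis using q_at0 by (simp add: order_0I)
    next
      case False
      then show ?thesis
        using laguerre_appell_exact(1)[OF P a, of n x] nK n1(2)[OF nK(2)] by (simp add: q degP)
    qed
    show "\<not> (poly (q (Suc n)) 0 = 0 \<and> poly (q n) 0 = 0)" using q_at0 by simp
  qed
  have iff: "Nnr = 0 \<longleftrightarrow> (\<forall>n. \<forall>z \<in># czeros (q n). z \<in> \<real>)"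
    unfolding real_iff
  proof
    assume "\<forall>n. zcount UNIV (q n) = n"
    then show "Nnr = 0" using n1(2)[of n1] Nnr by simp
  qed (use real_case(1) in blast)
  have "num_zeros_in \<real> (q n) + Nnr = n" if "n \<ge> n0" for n
    using n1(2)[of n] that Nnr unfolding num_real by (simp add: n0_def)
  with iff simple inter0 inter neg show ?thesis by blast
qed

end
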